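(* (1) Let $K$ be a two-dimensional local skew field whose residue skew field $K_1$ is commutative, and let $\alpha$ be its canonical automorphism. If $\alpha^n \neq \mathrm{id}$ for all integers $n \geq 1$, then $\mathrm{char}(K_2) = \mathrm{char}(K_1)$ (where $K_2 = K$), $K$ splits, and $K$ is isomorphic (as a two-dimensional local skew field) to the skew Laurent series field $K_1((t_2))$ in which $t_2 a = \alpha(a) t_2$ for all $a \in K_1$. (2) Let $K, K'$ be two-dimensional local skew fields whose residue skew fields $K_1, K'_1$ are commutative, with canonical automorphisms $\alpha, \alpha'$ respectively, and suppose $\alpha^n \neq \mathrm{id}$ and $\alpha'^n \neq \mathrm{id}$ for all $n \geq 1$. Then $K$ is isomorphic to $K'$ (as two-dimensional local skew fields) if and only if there is a field isomorphism $f : K_1 \to K'_1$ such that $\alpha = f^{-1}\alpha' f$.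
   Context: A skew field is a complete discrete valuation skew field if it is complete with respect to a discrete valuation (its residue skew field need not be commutative). A two-dimensional local skew field is a skew field $K = K_2$ such that $K_2$ is a complete discrete valuation skew field with residue skew field $K_1$, and $K_1$ is a complete discrete valuation skew field with residue skew field $K_0$. Write $\mathcal{O}_{K_2}, \mathcal{M}_{K_2}$ for the valuation ring and maximal ideal of $K_2$, similarly for $K_1$. $K$ splits if the residue homomorphism $\mathcal{O}_{K_2} \to K_1$ admits a ring-theoretic section. Canonical automorphism (when $K_1$ is commutative): for a prime element $t_2$ of $K_2$, the inner automorphism $y \mapsto t_2 y t_2^{-1}$ preserves $\mathcal{O}_{K_2}$ and $\mathcal{M}_{K_2}$ and hence induces an automorphism $\alpha$ of $K_1$; since $K_1$ is commutative this does not depend on the choice of $t_2$. Two two-dimensional local skew fields $K, K'$ are isomorphic if there is a ring isomorphism $K \to K'$ mapping $\mathcal{O}_K$ onto $\mathcal{O}_{K'}$, $\mathcal{M}_K$ onto $\mathcal{M}_{K'}$, and (on residue skew fields) $\mathcal{O}_{K_1}$ onto $\mathcal{O}_{K'_1}$, $\mathcal{M}_{K_1}$ onto $\mathcal{M}_{K'_1}$. For a field $K_1$ with automorphism $\alpha$, $K_1((t_2))$ denotes the skew field of formal Laurent series $\sum_{j \ge m} a_j t_2^j$ ($a_j \in K_1$) with multiplication determined by $t_2 a = \alpha(a) t_2$, with the $t_2$-adic valuation. *)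

theory Defs
  imports "HOL-Algebra.Algebra"
begin

definition skew_field :: "('a,'m) ring_scheme \<Rightarrow> bool" where
  "skew_field R \<longleftrightarrow> ring R \<and> \<one>\<^bsub>R\<^esub> \<noteq> \<zero>\<^bsub>R\<^esub> \<and>
     (\<forall>x \<in> carrier R - {\<zero>\<^bsub>R\<^esub>}. x \<in> Units R)"

text \<open>Normalised discrete valuation: v is only meaningful on nonzero elements
  (the value of the zero element is +infinity by convention, encoded via val_ge below).\<close>
definition discrete_valuation :: "('a,'m) ring_scheme \<Rightarrow> ('a \<Rightarrow> int) \<Rightarrow> bool" where
  "discrete_valuation R v \<longleftrightarrow>
     (\<forall>x \<in> carrier R - {\<zero>\<^bsub>R\<^esub>}. \<forall>y \<in> carrier R - {\<zero>\<^bsub>R\<^esub>}. v (x \<otimes>\<^bsub>R\<^esub> y) = v x + v y) \<and>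
     (\<forall>x \<in> carrier R - {\<zero>\<^bsub>R\<^esub>}. \<forall>y \<in> carrier R - {\<zero>\<^bsub>R\<^esub>}.
        x \<oplus>\<^bsub>R\<^esub> y \<noteq> \<zero>\<^bsub>R\<^esub> \<longrightarrow> min (v x) (v y) \<le> v (x \<oplus>\<^bsub>R\<^esub> y)) \<and>
     (\<exists>x \<in> carrier R - {\<zero>\<^bsub>R\<^esub>}. v x = 1)"

definition val_ge :: "('a,'m) ring_scheme \<Rightarrow> ('a \<Rightarrow> int) \<Rightarrow> int \<Rightarrow> 'a \<Rightarrow> bool" where
  "val_ge R v n x \<longleftrightarrow> x = \<zero>\<^bsub>R\<^esub> \<or> n \<le> v x"

definition val_complete :: "('a,'m) ring_scheme \<Rightarrow> ('a \<Rightarrow> int) \<Rightarrow> bool" where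
  "val_complete R v \<longleftrightarrow>
     (\<forall>s :: nat \<Rightarrow> 'a. (\<forall>k. s k \<in> carrier R) \<and>
        (\<forall>N::int. \<exists>M. \<forall>m\<ge>M. \<forall>n\<ge>M. val_ge R v N (s m \<ominus>\<^bsub>R\<^esub> s n)) \<longrightarrow>
        (\<exists>L \<in> carrier R. \<forall>N::int. \<exists>M. \<forall>n\<ge>M. val_ge R v N (s n \<ominus>\<^bsub>R\<^esub> L)))"

definition complete_dvsf :: "('a,'m) ring_scheme \<Rightarrow> ('a \<Rightarrow> int) \<Rightarrow> bool" where
  "complete_dvsf R v \<longleftrightarrow> skew_field R \<and> discrete_valuation R v \<and> val_complete R v"

definition valuation_ring :: "('a,'m) ring_scheme \<Rightarrow> ('a \<Rightarrow> int) \<Rightarrow> 'a set" where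
  "valuation_ring R v = {x \<in> carrier R. val_ge R v 0 x}"

definition valuation_ideal :: "('a,'m) ring_scheme \<Rightarrow> ('a \<Rightarrow> int) \<Rightarrow> 'a set" where
  "valuation_ideal R v = {x \<in> carrier R. val_ge R v 1 x}"

definition residue_field :: "('a,'m) ring_scheme \<Rightarrow> ('a \<Rightarrow> int) \<Rightarrow> 'a set ring" where
  "residue_field R v = (R\<lparr>carrier := valuation_ring R v\<rparr>) Quot (valuation_ideal R v)"

definition residue_map :: "('a,'m) ring_scheme \<Rightarrow> ('a \<Rightarrow> int) \<Rightarrow> 'a \<Rightarrow> 'a set" where
  "residue_map R v x = valuation_ideal R v +>\<^bsub>R\<^esub> x"

definition two_dim_local_skew_field ::
  "('a,'m) ring_scheme \<Rightarrow> ('a \<Rightarrow> int) \<Rightarrow> ('a set \<Rightarrow> int) \<Rightarrow> bool" where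
  "two_dim_local_skew_field R v2 v1 \<longleftrightarrow>
     complete_dvsf R v2 \<and> complete_dvsf (residue_field R v2) v1"

definition ring_char :: "('a,'m) ring_scheme \<Rightarrow> nat" where
  "ring_char R = (if \<exists>n::nat. 0 < n \<and> add_pow R n \<one>\<^bsub>R\<^esub> = \<zero>\<^bsub>R\<^esub>
                  then LEAST n::nat. 0 < n \<and> add_pow R n \<one>\<^bsub>R\<^esub> = \<zero>\<^bsub>R\<^esub> else 0)"

text \<open>Canonical automorphism of K_1: residue of y maps to residue of t y t^{-1},
  t a prime element (well defined when K_1 is commutative).\<close>
definition canonical_aut :: "('a,'m) ring_scheme \<Rightarrow> ('a \<Rightarrow> int) \<Rightarrow> 'a set \<Rightarrow> 'a set" where
  "canonical_aut R v Y =
     residue_map R v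
       ((SOME t. t \<in> carrier R \<and> t \<noteq> \<zero>\<^bsub>R\<^esub> \<and> v t = 1)
        \<otimes>\<^bsub>R\<^esub> (SOME y. y \<in> valuation_ring R v \<and> residue_map R v y = Y)
        \<otimes>\<^bsub>R\<^esub> m_inv R (SOME t. t \<in> carrier R \<and> t \<noteq> \<zero>\<^bsub>R\<^esub> \<and> v t = 1))"

definition aut_nonperiodic :: "('b,'n) ring_scheme \<Rightarrow> ('b \<Rightarrow> 'b) \<Rightarrow> bool" where
  "aut_nonperiodic F \<alpha> \<longleftrightarrow> (\<forall>n::nat. 1 \<le> n \<longrightarrow> (\<exists>Y \<in> carrier F. (\<alpha> ^^ n) Y \<noteq> Y))"

definition splits :: "('a,'m) ring_scheme \<Rightarrow> ('a \<Rightarrow> int) \<Rightarrow> bool" where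
  "splits R v \<longleftrightarrow>
     (\<exists>s \<in> ring_hom (residue_field R v) (R\<lparr>carrier := valuation_ring R v\<rparr>).
        \<forall>Y \<in> carrier (residue_field R v). residue_map R v (s Y) = Y)"

definition iso_2dlsf ::
  "('a,'m) ring_scheme \<Rightarrow> ('a \<Rightarrow> int) \<Rightarrow> ('a set \<Rightarrow> int) \<Rightarrow>
   ('c,'n) ring_scheme \<Rightarrow> ('c \<Rightarrow> int) \<Rightarrow> ('c set \<Rightarrow> int) \<Rightarrow> ('a \<Rightarrow> 'c) \<Rightarrow> bool" where
  "iso_2dlsf R v2 v1 R' v2' v1' \<phi> \<longleftrightarrow>
     \<phi> \<in> ring_iso R R' \<and>
     \<phi> ` valuation_ring R v2 = valuation_ring R' v2' \<and>
     \<phi> ` valuation_ideal R v2 = valuation_ideal R' v2' \<and>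
     {residue_map R' v2' (\<phi> x) | x. x \<in> valuation_ring R v2 \<and>
         residue_map R v2 x \<in> valuation_ring (residue_field R v2) v1}
       = valuation_ring (residue_field R' v2') v1' \<and>
     {residue_map R' v2' (\<phi> x) | x. x \<in> valuation_ring R v2 \<and>
         residue_map R v2 x \<in> valuation_ideal (residue_field R v2) v1}
       = valuation_ideal (residue_field R' v2') v1'"

definition isomorphic_2dlsf ::
  "('a,'m) ring_scheme \<Rightarrow> ('a \<Rightarrow> int) \<Rightarrow> ('a set \<Rightarrow> int) \<Rightarrow>
   ('c,'n) ring_scheme \<Rightarrow> ('c \<Rightarrow> int) \<Rightarrow> ('c set \<Rightarrow> int) \<Rightarrow> bool" where
  "isomorphic_2dlsf R v2 v1 R' v2' v1' \<longleftrightarrow> (\<exists>\<phi>. iso_2dlsf R v2 v1 R' v2' v1' \<phi>)"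

definition aut_ipow :: "('b,'n) ring_scheme \<Rightarrow> ('b \<Rightarrow> 'b) \<Rightarrow> int \<Rightarrow> 'b \<Rightarrow> 'b" where
  "aut_ipow F \<alpha> i x =
     (if 0 \<le> i then (\<alpha> ^^ nat i) x else (inv_into (carrier F) \<alpha> ^^ nat (- i)) x)"

definition laurent_carrier :: "('b,'n) ring_scheme \<Rightarrow> (int \<Rightarrow> 'b) set" where
  "laurent_carrier F = {f. (\<forall>n. f n \<in> carrier F) \<and> (\<exists>m. \<forall>n<m. f n = \<zero>\<^bsub>F\<^esub>)}"

text \<open>f represents sum_j f(j) t^j; (a t^i)(b t^j) = a alpha^i(b) t^(i+j).\<close>
definition skew_laurent :: "('b,'n) ring_scheme \<Rightarrow> ('b \<Rightarrow> 'b) \<Rightarrow> (int \<Rightarrow> 'b) ring" where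
  "skew_laurent F \<alpha> =
     \<lparr>partial_object.carrier = laurent_carrier F,
      monoid.mult = (\<lambda>f g n. \<Oplus>\<^bsub>F\<^esub> i \<in> {i. f i \<noteq> \<zero>\<^bsub>F\<^esub> \<and> g (n - i) \<noteq> \<zero>\<^bsub>F\<^esub>}.
                         f i \<otimes>\<^bsub>F\<^esub> aut_ipow F \<alpha> i (g (n - i))),
      monoid.one = (\<lambda>n. if n = 0 then \<one>\<^bsub>F\<^esub> else \<zero>\<^bsub>F\<^esub>),
      ring.zero = (\<lambda>n. \<zero>\<^bsub>F\<^esub>),
      ring.add = (\<lambda>f g n. f n \<oplus>\<^bsub>F\<^esub> g n)\<rparr>"

definition laurent_val :: "('b,'n) ring_scheme \<Rightarrow> (int \<Rightarrow> 'b) \<Rightarrow> int" where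
  "laurent_val F f = (THE n. f n \<noteq> \<zero>\<^bsub>F\<^esub> \<and> (\<forall>m<n. f m = \<zero>\<^bsub>F\<^esub>))"

text \<open>The residue field of F((t)) is identified with F via the constant term;
  transport the valuation v1 of F along this identification.\<close>
definition laurent_res_val :: "('b \<Rightarrow> int) \<Rightarrow> (int \<Rightarrow> 'b) set \<Rightarrow> int" where
  "laurent_res_val v1 Y = v1 ((SOME f. f \<in> Y) 0)"

end

theory Submission
  imports Defs
begin

text \<open>
  Automorphisms of the complete field $K_1$ preserve its valuation (F. K. Schmidt), so the fixed
  fields of the powers of $\alpha$ are proper closed subfields and, by Baire, some $c \in K_1$
  satisfies $\alpha^n(c) \ne c$ for all $n \ge 1$. Let $a$ be a lift of $c$. On the graded piece
  of degree $n$, the map $x \mapsto xa - bx$ is multiplication by $\alpha^n(c) - \bar b$. With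
  $b = a$ it is bijective in all degrees $n \ge 1$, so every element of $K_1$ has a unique lift
  commuting with $a$: these lifts form a section $s$. With $b = s(\alpha(c))$ it is bijective in
  all degrees $n \ge 2$, so any prime element can be corrected to some $t$ with $t a = b t$, and then
  uniqueness of lifts gives $t\, s(y) = s(\alpha(y))\, t$ for all $y$. Expanding in powers of $t$
  with coefficients in $s(K_1)$ identifies $K$ with the skew Laurent series over any field
  isomorphic to $(K_1, \alpha)$, and Schmidt's theorem takes care of the second valuation.
\<close>

section \<open>Discrete valuations and residue fields\<close>

text \<open>Nonperiodicity only yields, for each n, some element moved by \<alpha>^n, whereas the
  lifting argument divides by \<alpha>^n(c) - c in all degrees at once; this is why one c must serve
  every n. Baire needs the powers of \<alpha> to be continuous, but \<alpha> arises from conjugation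
  in K and nothing relates it to the valuation of K_1 except the uniqueness of that valuation. In
  degree 0 the factor for b = a is c - c = 0, which is what leaves the residue of a commuting lift
  free. In degree 1 the factor for b = s(\<alpha>(c)) is \<alpha>(c) - \<alpha>(c) = 0, so the
  correction of the prime element starts in degree 2 and keeps its leading term. Conjugation by the
  corrected t turns a into b, hence elements commuting with a into elements commuting with b;
  s(\<alpha>(y)) is one of the latter because K_1 is commutative. No step distinguishes
  characteristics: their equality is a consequence of the section.\<close>

locale dvsf = ring R for R :: "('a, 'm) ring_scheme" (structure) +
  fixes v :: "'a \<Rightarrow> int"
  assumes one_not_zero: "\<one> \<noteq> \<zero>"
    and nonzero_Units: "\<lbrakk>x \<in> carrier R; x \<noteq> \<zero>\<rbrakk> \<Longrightarrow> x \<in> Units R"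
    and val_mult: "\<lbrakk>x \<in> carrier R; x \<noteq> \<zero>; y \<in> carrier R; y \<noteq> \<zero>\<rbrakk> \<Longrightarrow> v (x \<otimes> y) = v x + v y"
    and val_add: "\<lbrakk>x \<in> carrier R; x \<noteq> \<zero>; y \<in> carrier R; y \<noteq> \<zero>; x \<oplus> y \<noteq> \<zero>\<rbrakk>
      \<Longrightarrow> min (v x) (v y) \<le> v (x \<oplus> y)"
    and val_surj_one: "\<exists>x \<in> carrier R. x \<noteq> \<zero> \<and> v x = 1"

lemma dvsf_iff: "dvsf R v \<longleftrightarrow> skew_field R \<and> discrete_valuation R v"
  unfolding dvsf_def dvsf_axioms_def skew_field_def discrete_valuation_def by auto

context dvsf begin

lemma Units_iff: "x \<in> Units R \<longleftrightarrow> x \<in> carrier R \<and> x \<noteq> \<zero>"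
proof -
  have "\<zero> \<notin> Units R"
    using one_not_zero Units_l_inv Units_inv_closed l_null r_null by (metis)
  then show ?thesis using nonzero_Units by auto
qed

lemma inv_nonzero_closed [simp]: "\<lbrakk>x \<in> carrier R; x \<noteq> \<zero>\<rbrakk> \<Longrightarrow> inv x \<in> carrier R"
  and inv_nonzero [simp]: "\<lbrakk>x \<in> carrier R; x \<noteq> \<zero>\<rbrakk> \<Longrightarrow> inv x \<noteq> \<zero>"
  and l_inv_nonzero [simp]: "\<lbrakk>x \<in> carrier R; x \<noteq> \<zero>\<rbrakk> \<Longrightarrow> inv x \<otimes> x = \<one>"
  and r_inv_nonzero [simp]: "\<lbrakk>x \<in> carrier R; x \<noteq> \<zero>\<rbrakk> \<Longrightarrow> x \<otimes> inv x = \<one>"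
  using Units_iff Units_inv_Units by auto

lemma mult_eq_zero_iff [simp]:
  "\<lbrakk>x \<in> carrier R; y \<in> carrier R\<rbrakk> \<Longrightarrow> x \<otimes> y = \<zero> \<longleftrightarrow> x = \<zero> \<or> y = \<zero>"
  by (metis inv_nonzero_closed l_inv_nonzero l_null l_one m_assoc r_null)

lemma mult_left_cancel:
  assumes "x \<in> carrier R" "x \<noteq> \<zero>" "y \<in> carrier R" "z \<in> carrier R"
  shows "x \<otimes> y = x \<otimes> z \<longleftrightarrow> y = z"
  using assms by (metis inv_nonzero_closed l_inv_nonzero l_one m_assoc)

lemma mult_right_cancel:
  assumes "x \<in> carrier R" "x \<noteq> \<zero>" "y \<in> carrier R" "z \<in> carrier R"
  shows "y \<otimes> x = z \<otimes> x \<longleftrightarrow> y = z"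
  using assms by (metis inv_nonzero_closed r_inv_nonzero r_one m_assoc)

lemma val_one [simp]: "v \<one> = 0"
  using val_mult[of \<one> \<one>] one_not_zero by simp

lemma val_inv: "\<lbrakk>x \<in> carrier R; x \<noteq> \<zero>\<rbrakk> \<Longrightarrow> v (inv x) = - v x"
  using val_mult[of "inv x" x] by simp

lemma minus_eq_zero_iff [simp]: "x \<in> carrier R \<Longrightarrow> \<ominus> x = \<zero> \<longleftrightarrow> x = \<zero>"
  by (metis minus_minus minus_zero)

lemma val_minus [simp]: assumes "x \<in> carrier R" shows "v (\<ominus> x) = v x"
proof (cases "x = \<zero>")
  case False
  have n: "\<ominus> \<one> \<noteq> \<zero>" using one_not_zero by simp
  have "\<ominus> \<one> \<otimes> \<ominus> \<one> = \<one>" by (simp add: l_minus)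
  then have "v (\<ominus> \<one>) = 0"
    using val_mult[of "\<ominus> \<one>" "\<ominus> \<one>"] n by simp
  moreover have "\<ominus> x = \<ominus> \<one> \<otimes> x" using assms by (simp add: l_minus)
  ultimately show ?thesis using val_mult[of "\<ominus> \<one>" x] n assms False by simp
qed simp

text \<open>The balls around zero. Zero lies in all of them whatever \<open>v\<close> returns there,
  so that arguments about differences need no separate treatment of the value infinity.\<close>

definition fil :: "int \<Rightarrow> 'a set" where
  "fil n = {x \<in> carrier R. val_ge R v n x}"

lemma fil_iff: "x \<in> fil n \<longleftrightarrow> x \<in> carrier R \<and> (x \<noteq> \<zero> \<longrightarrow> n \<le> v x)"
  by (auto simp: fil_def val_ge_def)

lemma valuation_ring_eq: "valuation_ring R v = fil 0"
  and valuation_ideal_eq: "valuation_ideal R v = fil 1"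
  by (auto simp: fil_def valuation_ring_def valuation_ideal_def)

lemma fil_carrier: "x \<in> fil n \<Longrightarrow> x \<in> carrier R"
  by (simp add: fil_iff)

lemma fil_zero [simp]: "\<zero> \<in> fil n"
  by (simp add: fil_iff)

lemma fil_mono: "\<lbrakk>x \<in> fil n; m \<le> n\<rbrakk> \<Longrightarrow> x \<in> fil m"
  by (auto simp: fil_iff)

lemma fil_add: "\<lbrakk>x \<in> fil n; y \<in> fil n\<rbrakk> \<Longrightarrow> x \<oplus> y \<in> fil n"
  using val_add[of x y] by (cases "x = \<zero>"; cases "y = \<zero>") (auto simp: fil_iff)

lemma fil_uminus: "x \<in> fil n \<Longrightarrow> \<ominus> x \<in> fil n"
  by (auto simp: fil_iff)

lemma fil_minus: "\<lbrakk>x \<in> fil n; y \<in> fil n\<rbrakk> \<Longrightarrow> x \<ominus> y \<in> fil n"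
  by (simp add: minus_eq fil_add fil_uminus)

lemma fil_mult: "\<lbrakk>x \<in> fil n; y \<in> fil m\<rbrakk> \<Longrightarrow> x \<otimes> y \<in> fil (n + m)"
  using val_mult[of x y] by (auto simp: fil_iff)

lemma fil_mult_l: "\<lbrakk>x \<in> fil 0; y \<in> fil m\<rbrakk> \<Longrightarrow> x \<otimes> y \<in> fil m"
  using fil_mult[of x 0 y m] by simp

lemma fil_mult_r: "\<lbrakk>x \<in> fil m; y \<in> fil 0\<rbrakk> \<Longrightarrow> x \<otimes> y \<in> fil m"
  using fil_mult[of x m y 0] by simp

lemma fil_one [simp]: "\<one> \<in> fil 0"
  by (simp add: fil_iff)

lemma fil_minus_swap:
  assumes "x \<ominus> y \<in> fil n" "x \<in> carrier R" "y \<in> carrier R" shows "y \<ominus> x \<in> fil n"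
proof -
  have "y \<ominus> x = \<ominus> (x \<ominus> y)" using assms(2,3) by algebra
  with fil_uminus[OF assms(1)] show ?thesis by simp
qed

lemma fil_minus_trans:
  assumes "x \<ominus> y \<in> fil n" "y \<ominus> z \<in> fil n" "x \<in> carrier R" "y \<in> carrier R" "z \<in> carrier R"
  shows "x \<ominus> z \<in> fil n"
proof -
  have "x \<ominus> z = (x \<ominus> y) \<oplus> (y \<ominus> z)" using assms(3-5) by algebra
  with fil_add[OF assms(1,2)] show ?thesis by simp
qed

lemma fil_minus_cancel:
  assumes "x \<ominus> y \<in> fil n" "y \<in> fil n" "x \<in> carrier R"
  shows "x \<in> fil n"
proof -
  have "y \<in> carrier R" using assms fil_carrier by blast
  then have "x = (x \<ominus> y) \<oplus> y" using assms(3) by algebra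
  with fil_add[OF assms(1,2)] show ?thesis by simp
qed

text \<open>The filtration is separated. The free base point \<open>n\<close> matches the bounds
  \<open>N + int k\<close> that \<open>fil_limit\<close> delivers.\<close>

lemma eq_zero_if_fil: "(\<And>k::nat. x \<in> fil (n + int k)) \<Longrightarrow> x = \<zero>"
proof (rule ccontr)
  assume *: "\<And>k::nat. x \<in> fil (n + int k)" and "x \<noteq> \<zero>"
  then have "n + int (nat (v x - n + 1)) \<le> v x" using *[of "nat (v x - n + 1)"] by (auto simp: fil_iff)
  then show False by linarith
qed

lemma eq_if_fil:
  assumes "\<And>k::nat. x \<ominus> y \<in> fil (n + int k)" "x \<in> carrier R" "y \<in> carrier R"
  shows "x = y"
  using eq_zero_if_fil[OF assms(1)] assms(2,3) by (simp add: r_right_minus_eq)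

lemma in_some_fil: "x \<in> carrier R \<Longrightarrow> \<exists>n. x \<in> fil n"
  by (cases "x = \<zero>") (auto simp: fil_iff)

section \<open>Residue field and residue map\<close>

abbreviation res :: "'a \<Rightarrow> 'a set" where "res \<equiv> residue_map R v"
abbreviation K1 :: "'a set ring" where "K1 \<equiv> residue_field R v"


lemma valuation_subring: "ring (R\<lparr>carrier := fil 0\<rparr>)"
proof -
  have "subring (fil 0) R"
    by (rule subringI) (auto simp: fil_carrier fil_uminus fil_mult_l fil_add)
  then show ?thesis by (rule subring_is_ring)
qed

lemma valuation_ideal: "ideal (fil 1) (R\<lparr>carrier := fil 0\<rparr>)"
proof (rule idealI[OF valuation_subring])
  show "subgroup (fil 1) (add_monoid (R\<lparr>carrier := fil 0\<rparr>))"
  proof (rule group.subgroupI)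
    show "group (add_monoid (R\<lparr>carrier := fil 0\<rparr>))"
      using valuation_subring ring.is_abelian_group abelian_group.a_group by blast
    show "inv\<^bsub>add_monoid (R\<lparr>carrier := fil 0\<rparr>)\<^esub> x \<in> fil 1" if "x \<in> fil 1" for x
    proof -
      have *: "x \<in> fil 0" using that fil_mono[of x 1 0] by simp
      have "inv\<^bsub>add_monoid (R\<lparr>carrier := fil 0\<rparr>)\<^esub> x = \<ominus> x"
        using ring.is_abelian_group[OF valuation_subring, THEN abelian_group.a_group,
            THEN group.inv_equality, of "\<ominus> x" x] * fil_uminus fil_carrier l_neg by simp
      then show ?thesis using fil_uminus that by simp
    qed
  qed (use fil_mono[of _ 1 0] fil_add in \<open>auto intro: fil_zero\<close>)
qed (auto intro: fil_mult_l fil_mult_r)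

text \<open>Cosets involve only the addition, which restricting the carrier leaves alone; the
  general theory of quotients by ideals thus applies to \<open>res\<close>.\<close>

lemma res_eq: "res = (+>\<^bsub>R\<lparr>carrier := fil 0\<rparr>\<^esub>) (fil 1)"
  by (simp add: fun_eq_iff residue_map_def valuation_ideal_eq a_r_coset_def r_coset_def)

lemma K1_eq: "K1 = R\<lparr>carrier := fil 0\<rparr> Quot fil 1"
  by (simp add: residue_field_def valuation_ring_eq valuation_ideal_eq)

lemma res_hom: "res \<in> ring_hom (R\<lparr>carrier := fil 0\<rparr>) K1"
  unfolding res_eq K1_eq by (rule ideal.rcos_ring_hom[OF valuation_ideal])

lemma ring_K1: "ring K1"
  unfolding K1_eq by (rule ideal.quotient_is_ring[OF valuation_ideal])

lemma res_closed [simp]: "x \<in> fil 0 \<Longrightarrow> res x \<in> carrier K1"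
  and res_mult: "\<lbrakk>x \<in> fil 0; y \<in> fil 0\<rbrakk> \<Longrightarrow> res (x \<otimes> y) = res x \<otimes>\<^bsub>K1\<^esub> res y"
  and res_add: "\<lbrakk>x \<in> fil 0; y \<in> fil 0\<rbrakk> \<Longrightarrow> res (x \<oplus> y) = res x \<oplus>\<^bsub>K1\<^esub> res y"
  and res_one: "res \<one> = \<one>\<^bsub>K1\<^esub>"
  using res_hom by (auto simp: ring_hom_def)

lemma res_surj: "Y \<in> carrier K1 \<Longrightarrow> \<exists>y \<in> fil 0. res y = Y"
  unfolding res_eq K1_eq FactRing_simps by auto

lemma zero_K1: "\<zero>\<^bsub>K1\<^esub> = fil 1"
  by (simp add: K1_eq FactRing_def)

lemma res_altdef: "res x = {h \<oplus> x | h. h \<in> fil 1}"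
  by (auto simp: residue_map_def valuation_ideal_eq a_r_coset_def r_coset_def)

lemma res_eq_zero_iff:
  assumes "x \<in> fil 0" shows "res x = \<zero>\<^bsub>K1\<^esub> \<longleftrightarrow> x \<in> fil 1"
proof
  have "x \<in> res x" using assms by (auto simp: res_altdef fil_carrier intro!: exI[of _ \<zero>])
  then show "x \<in> fil 1" if "res x = \<zero>\<^bsub>K1\<^esub>" using that zero_K1 by simp
next
  assume x: "x \<in> fil 1"
  have "h = (h \<ominus> x) \<oplus> x" if "h \<in> fil 1" for h
    using that x fil_carrier by algebra
  then show "res x = \<zero>\<^bsub>K1\<^esub>" unfolding res_altdef zero_K1
    using x fil_add fil_minus by blast
qed

lemma res_zero: "res \<zero> = \<zero>\<^bsub>K1\<^esub>"
  using res_eq_zero_iff[of \<zero>] by simp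

lemma res_minus: "\<lbrakk>x \<in> fil 0; y \<in> fil 0\<rbrakk> \<Longrightarrow> res (x \<ominus> y) = res x \<ominus>\<^bsub>K1\<^esub> res y"
proof -
  assume a: "x \<in> fil 0" "y \<in> fil 0"
  interpret K1: ring K1 by (rule ring_K1)
  have "(x \<ominus> y) \<oplus> y = x" using a[THEN fil_carrier] by algebra
  then have *: "res (x \<ominus> y) \<oplus>\<^bsub>K1\<^esub> res y = res x" using a res_add fil_minus by metis
  have "res (x \<ominus> y) \<in> carrier K1" "res y \<in> carrier K1" using a fil_minus by auto
  then have "res (x \<ominus> y) = (res (x \<ominus> y) \<oplus>\<^bsub>K1\<^esub> res y) \<ominus>\<^bsub>K1\<^esub> res y" by algebra
  then show ?thesis using * by simp
qed

lemma res_eq_iff: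
  assumes "x \<in> fil 0" "y \<in> fil 0" shows "res x = res y \<longleftrightarrow> x \<ominus> y \<in> fil 1"
proof -
  interpret K1: ring K1 by (rule ring_K1)
  show ?thesis
    using res_eq_zero_iff[of "x \<ominus> y"] assms by (simp add: fil_minus res_minus K1.r_right_minus_eq)
qed

end

section \<open>Completeness and uniqueness of the valuation\<close>

locale uniformized_dvsf = dvsf +
  fixes t
  assumes t_carrier [simp]: "t \<in> carrier R" and t_nonzero [simp]: "t \<noteq> \<zero>" and val_t [simp]: "v t = 1"
begin

text \<open>Taken in the group of units, so that negative exponents are available and the exponent
  law holds for all integers.\<close>

definition T :: "int \<Rightarrow> 'a" where "T i = t [^]\<^bsub>units_of R\<^esub> i"

lemma T_Units: "T i \<in> Units R"
  and T_add: "T (i + j) = T i \<otimes> T j"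
  and T_0 [simp]: "T 0 = \<one>"
  and T_1 [simp]: "T 1 = t"
proof -
  interpret U: group "units_of R" by (rule units_group)
  have t: "t \<in> carrier (units_of R)" by (simp add: units_of_def Units_iff)
  show "T i \<in> Units R" using U.int_pow_closed[OF t, of i] by (simp add: T_def units_of_def)
  show "T (i + j) = T i \<otimes> T j" using U.int_pow_mult[OF t, of i j] by (simp add: T_def units_of_def)
  show "T 0 = \<one>" by (simp add: T_def units_of_def)
  show "T 1 = t" using U.int_pow_1[OF t] by (simp add: T_def)
qed

lemma T_carrier [simp]: "T i \<in> carrier R" and T_nonzero [simp]: "T i \<noteq> \<zero>"
  using T_Units Units_iff by auto

lemma T_cancel [simp]: "T i \<otimes> T (- i) = \<one>" "T (- i) \<otimes> T i = \<one>"
  by (simp_all flip: T_add)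

lemma val_T [simp]: "v (T i) = i"
proof -
  have *: "v (T (int n)) = int n" for n
  proof (induction n)
    case (Suc n)
    have "T (int (Suc n)) = t \<otimes> T (int n)" using T_add[of 1 "int n"] by simp
    with Suc show ?case by (simp add: val_mult)
  qed simp
  show ?thesis
  proof (cases "0 \<le> i")
    case False
    then have "v (T (- i)) = - i" using *[of "nat (- i)"] by simp
    moreover have "v (T i \<otimes> T (- i)) = v (T i) + v (T (- i))" by (simp add: val_mult del: T_cancel)
    ultimately show ?thesis by simp
  qed (use *[of "nat i"] in simp)
qed

lemma T_fil: "m \<le> n \<Longrightarrow> T n \<in> fil m"
  by (simp add: fil_iff)

text \<open>Division is from the right, so that the coefficient stands to the left of the power of
  \<open>t\<close>, as in the Laurent series.\<close>

lemma fil_divide: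
  assumes "x \<in> fil n" obtains w where "w \<in> fil 0" "x = w \<otimes> T n"
proof -
  have x: "x \<in> carrier R" using assms fil_carrier by blast
  have "x \<otimes> T (- n) \<in> fil 0" using fil_mult[OF assms T_fil[of "- n" "- n"]] by simp
  moreover have "x = (x \<otimes> T (- n)) \<otimes> T n" using x by (simp add: m_assoc)
  ultimately show ?thesis using that by blast
qed

lemma fil_T_iff: "w \<in> carrier R \<Longrightarrow> w \<otimes> T n \<in> fil (m + n) \<longleftrightarrow> w \<in> fil m"
  by (cases "w = \<zero>") (auto simp: fil_iff val_mult)

end

lemma (in dvsf) ex_uniformizer: obtains t where "uniformized_dvsf R v t"
  using val_surj_one dvsf_axioms unfolding uniformized_dvsf_def uniformized_dvsf_axioms_def by blast

section \<open>Completeness in terms of the filtration\<close>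

locale complete_dvsf_loc = dvsf +
  assumes complete: "val_complete R v"
begin

text \<open>By the ultrametric inequality, bounds on consecutive differences already give a Cauchy
  sequence. The limit inherits the rate: split \<open>L - s k\<close> at a far later term
  \<open>s (k + j)\<close>.\<close>

lemma fil_limit:
  assumes s: "\<And>k. s k \<in> carrier R" and d: "\<And>k::nat. s (Suc k) \<ominus> s k \<in> fil (N + int k)"
  obtains L where "L \<in> carrier R" "\<And>k. L \<ominus> s k \<in> fil (N + int k)"
proof -
  have *: "s (k + j) \<ominus> s k \<in> fil (N + int k)" for k j
  proof (induction j)
    case 0 then show ?case using s by (simp add: r_neg minus_eq)
  next
    case (Suc j)
    have "s (k + Suc j) \<ominus> s (k + j) \<in> fil (N + int k)" using fil_mono[OF d[of "k + j"]] by simp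
    then show ?case using fil_minus_trans[OF _ Suc s s s] by blast
  qed
  have c: "s m \<ominus> s n \<in> fil M" if "m \<ge> nat (M - N)" "n \<ge> nat (M - N)" for m n M
  proof -
    let ?k = "nat (M - N)"
    have "s m \<ominus> s ?k \<in> fil (N + int ?k)" "s n \<ominus> s ?k \<in> fil (N + int ?k)"
      using *[of ?k "m - ?k"] *[of ?k "n - ?k"] that by simp_all
    then have "s m \<ominus> s n \<in> fil (N + int ?k)"
      using s fil_minus_trans[OF _ fil_minus_swap[OF _ s s] s s s] by blast
    then show ?thesis using fil_mono by simp
  qed
  have "\<forall>M. \<exists>k. \<forall>m\<ge>k. \<forall>n\<ge>k. val_ge R v M (s m \<ominus> s n)"
    using c unfolding fil_def by blast
  then obtain L where L: "L \<in> carrier R" "\<And>M. \<exists>k. \<forall>n\<ge>k. val_ge R v M (s n \<ominus> L)"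
    using complete[unfolded val_complete_def, THEN spec[of _ s]] s by metis
  have "L \<ominus> s k \<in> fil (N + int k)" for k
  proof -
    obtain j where j: "val_ge R v (N + int k) (s (k + j) \<ominus> L)"
      using L(2)[of "N + int k"] by (metis le_add2)
    then have "s (k + j) \<ominus> L \<in> fil (N + int k)" using s L by (simp add: fil_def)
    from fil_minus_trans[OF fil_minus_swap[OF this s L(1)] *[of k j] L(1) s s] show ?thesis .
  qed
  with L that show ?thesis by blast
qed

text \<open>Artin--Schreier roots are iterated limits of the contraction $y \mapsto y^2 - x$,
  so no assumption on the residue characteristic is needed, unlike for $n$-th roots.\<close>
lemma artin_schreier:
  assumes "cring R" "x \<in> fil 1"
  obtains y where "y \<in> fil 1" "x = y \<otimes> y \<ominus> y"
proof -
  interpret cring R by fact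
  have x: "x \<in> carrier R" using assms fil_carrier by blast
  define s where "s = rec_nat \<zero> (\<lambda>_ y. y \<otimes> y \<ominus> x)"
  have s0: "s 0 = \<zero>" and sS: "s (Suc k) = s k \<otimes> s k \<ominus> x" for k by (simp_all add: s_def)
  have s1: "s k \<in> fil 1" for k
    by (induction k) (use assms fil_mult_l fil_mono[of _ 1 0] fil_minus in \<open>auto simp: s0 sS\<close>)
  have s: "s k \<in> carrier R" for k using s1 fil_carrier by blast
  \<comment> \<open>Squaring contracts the maximal ideal: the difference of squares factors, and the
    factor a + b gains one degree.\<close>
  have sq: "a \<otimes> a \<ominus> b \<otimes> b \<in> fil (1 + n)" if "a \<in> fil 1" "b \<in> fil 1" "a \<ominus> b \<in> fil n" for a b n
  proof -
    have "a \<otimes> a \<ominus> b \<otimes> b = (a \<oplus> b) \<otimes> (a \<ominus> b)" using that(1,2)[THEN fil_carrier] by algebra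
    then show ?thesis using fil_mult[OF fil_add that(3)] that by simp
  qed
  have d: "s (Suc k) \<ominus> s k \<in> fil (1 + int k)" for k
  proof (induction k)
    case 0 then show ?case using s1[of 1] s by (simp add: s0 minus_eq)
  next
    case (Suc k)
    have "s (Suc (Suc k)) \<ominus> s (Suc k) = s (Suc k) \<otimes> s (Suc k) \<ominus> s k \<otimes> s k"
      unfolding sS[of "Suc k"] sS[of k] using s[of k] s[of "Suc k"] x
      by algebra
    then show ?case using sq[OF s1 s1 Suc] by simp
  qed
  obtain y where y: "y \<in> carrier R" "\<And>k. y \<ominus> s k \<in> fil (1 + int k)"
    using fil_limit[OF s d] by blast
  have y1: "y \<in> fil 1" using fil_minus_cancel y(2)[of 0] s1 y(1) by simp
  have "(y \<otimes> y \<ominus> y) \<ominus> x \<in> fil (1 + int k)" for k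
  proof -
    have "(y \<otimes> y \<ominus> y) \<ominus> x = (y \<otimes> y \<ominus> s k \<otimes> s k) \<ominus> (y \<ominus> s (Suc k))"
      unfolding sS using y(1) s[of k] x by algebra
    moreover have "y \<otimes> y \<ominus> s k \<otimes> s k \<in> fil (1 + int k)"
      using fil_mono[OF sq[OF y1 s1 y(2)]] by simp
    moreover have "y \<ominus> s (Suc k) \<in> fil (1 + int k)" using fil_mono[OF y(2)[of "Suc k"]] by simp
    ultimately show ?thesis using fil_minus by simp
  qed
  then have "y \<otimes> y \<ominus> y = x" using x y(1) by (intro eq_if_fil[of _ _ 1]) auto
  then show ?thesis using that y1 by metis
qed

end

lemma complete_dvsf_loc_iff: "complete_dvsf_loc R v \<longleftrightarrow> complete_dvsf R v"
  by (simp add: complete_dvsf_loc_def complete_dvsf_loc_axioms_def complete_dvsf_def dvsf_iff)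

text \<open>F. K. Schmidt's theorem. An element \<open>x\<close> of the maximal ideal of \<open>v\<close> is $y^2 - y$ with \<open>y\<close> in
  that ideal, and $w(x) < w(y) < 0$ if $w(x) < 0$; descent gives $w(x) \ge 0$.\<close>
lemma valuation_unique:
  assumes "complete_dvsf_loc F v" "cring F" "dvsf F w" "x \<in> carrier F" "x \<noteq> \<zero>\<^bsub>F\<^esub>"
  shows "w x = v x"
proof -
  interpret cring F by fact
  interpret V: complete_dvsf_loc F v by fact
  interpret W: dvsf F w by fact
  obtain t where "uniformized_dvsf F v t" by (rule V.ex_uniformizer)
  then interpret V: uniformized_dvsf F v t .
  have M: "y \<in> W.fil 0" if "y \<in> V.fil 1" for y
    using that
  proof (induction "nat (- w y)" arbitrary: y rule: less_induct)
    case less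
    obtain z where z: "z \<in> V.fil 1" "y = z \<otimes>\<^bsub>F\<^esub> z \<ominus>\<^bsub>F\<^esub> z"
      by (rule V.artin_schreier[OF \<open>cring F\<close> less.prems])
    note zc = V.fil_carrier[OF z(1)]
    have y: "y = z \<otimes>\<^bsub>F\<^esub> (z \<ominus>\<^bsub>F\<^esub> \<one>\<^bsub>F\<^esub>)" using z(2) zc by algebra
    have yc: "y \<in> carrier F" using less.prems V.fil_carrier by blast
    show ?case
    proof (rule ccontr)
      assume n: "y \<notin> W.fil 0"
      have 1: "z \<notin> W.fil 0"
        using n y W.fil_mult_l W.fil_minus W.fil_one by metis
      have 2: "z \<ominus>\<^bsub>F\<^esub> \<one>\<^bsub>F\<^esub> \<notin> W.fil 0"
        using 1 W.fil_minus_cancel[OF _ W.fil_one zc] by blast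
      have "w y = w z + w (z \<ominus>\<^bsub>F\<^esub> \<one>\<^bsub>F\<^esub>)"
        using 1 2 y zc W.val_mult by (auto simp: W.fil_iff)
      then have "nat (- w z) < nat (- w y)" using 1 2 zc by (auto simp: W.fil_iff)
      then show False using less.hyps[OF _ z(1)] 1 by blast
    qed
  qed
  have O: "0 \<le> w y" if y: "y \<in> carrier F" "y \<noteq> \<zero>\<^bsub>F\<^esub>" "0 \<le> v y" for y
  proof (rule ccontr)
    assume "\<not> 0 \<le> w y"
    have "y [^]\<^bsub>F\<^esub> n \<noteq> \<zero>\<^bsub>F\<^esub> \<and> w (y [^]\<^bsub>F\<^esub> n) = int n * w y \<and> 0 \<le> v (y [^]\<^bsub>F\<^esub> n)" for n :: nat
      using y by (induction n) (auto simp: V.val_mult W.val_mult V.one_not_zero algebra_simps)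
    note p = this[THEN conjunct1] this[THEN conjunct2, THEN conjunct1] this[THEN conjunct2, THEN conjunct2]
    \<comment> \<open>Since \<open>w y\<close> is at most -1, this exponent makes the
      \<open>w\<close>-value of t y^n negative, although t y^n lies in the maximal ideal of
      \<open>v\<close>.\<close>
    define n where "n = nat (w t + 1)"
    have "t \<otimes>\<^bsub>F\<^esub> y [^]\<^bsub>F\<^esub> n \<in> W.fil 0"
      using y p by (intro M) (auto simp: V.fil_iff V.val_mult)
    then have "0 \<le> w t + int n * w y" using y p by (auto simp: W.fil_iff W.val_mult)
    moreover have "int n * w y \<le> int n * (-1)"
      using \<open>\<not> 0 \<le> w y\<close> by (intro mult_left_mono) auto
    ultimately show False by (simp add: n_def split: if_splits)
  qed
  have O0: "w y = 0" if y: "y \<in> carrier F" "y \<noteq> \<zero>\<^bsub>F\<^esub>" "v y = 0" for y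
    using O[of y] O[of "inv\<^bsub>F\<^esub> y"] y by (simp add: V.val_inv W.val_inv)
  have wT: "w (V.T i) = i * w t" for i
  proof -
    have *: "w (V.T (int n)) = int n * w t" for n
    proof (induction n)
      case (Suc n)
      have "V.T (int (Suc n)) = t \<otimes>\<^bsub>F\<^esub> V.T (int n)" using V.T_add[of 1 "int n"] by simp
      with Suc show ?case by (simp add: W.val_mult algebra_simps)
    qed simp
    show ?thesis
    proof (cases "0 \<le> i")
      case False
      then have "w (V.T (- i)) = - i * w t" using *[of "nat (- i)"] by simp
      moreover have "w (V.T i \<otimes>\<^bsub>F\<^esub> V.T (- i)) = w (V.T i) + w (V.T (- i))"
        by (simp add: W.val_mult del: V.T_cancel)
      ultimately show ?thesis by simp
    qed (use *[of "nat i"] in simp)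
  qed
  have wv: "w y = v y * w t" if y: "y \<in> carrier F" "y \<noteq> \<zero>\<^bsub>F\<^esub>" for y
  proof -
    have "w (y \<otimes>\<^bsub>F\<^esub> V.T (- v y)) = 0" using y by (intro O0) (auto simp: V.val_mult)
    then show ?thesis using y by (simp add: W.val_mult wT)
  qed
  obtain z where z: "z \<in> carrier F" "z \<noteq> \<zero>\<^bsub>F\<^esub>" "w z = 1" using W.val_surj_one by blast
  \<comment> \<open>So far \<open>w\<close> is \<open>v\<close> times the constant
    \<open>w t\<close>. Because \<open>w\<close> takes the value 1, the constant divides 1, and its
    sign is known from \<open>O\<close>.\<close>
  then have "v z * w t = 1" using wv[of z] by metis
  then have "w t = 1" using O[of t] by (auto simp: zmult_eq_1_iff)
  then show ?thesis using wv[OF assms(4,5)] by simp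
qed

lemma dvsf_pullback:
  assumes "h \<in> ring_iso F G" "dvsf F v" "dvsf G w"
  shows "dvsf F (w \<circ> h)"
proof -
  interpret F: dvsf F v by fact
  interpret G: dvsf G w by fact
  note h = ring_iso_memE[OF assms(1)]
  have h0: "h \<zero>\<^bsub>F\<^esub> = \<zero>\<^bsub>G\<^esub>"
    using ring_hom_zero[of h F G] assms(1) F.ring_axioms G.ring_axioms by (simp add: ring_iso_def)
  have inj: "h x = \<zero>\<^bsub>G\<^esub> \<longleftrightarrow> x = \<zero>\<^bsub>F\<^esub>" if "x \<in> carrier F" for x
    using h(5) that h0 unfolding bij_betw_def inj_on_def by (metis F.zero_closed)
  show ?thesis
  proof (unfold_locales, goal_cases)
    case (4 x y) then show ?case using G.val_add[of "h x" "h y"] h(1)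
      by (auto simp: inj simp flip: h(3))
  next
    case 5
    obtain z where "z \<in> carrier G" "z \<noteq> \<zero>\<^bsub>G\<^esub>" "w z = 1" using G.val_surj_one by blast
    then show ?case using h(5) h0 unfolding bij_betw_def by (metis comp_apply imageE)
  qed (auto simp: F.one_not_zero F.nonzero_Units h(1,2) inj G.val_mult)
qed

text \<open>The valuation pulled back along \<open>h\<close> is a second valuation on
  \<open>F\<close>, so uniqueness applies. This is what makes the powers of \<alpha> continuous and
  lets an abstract isomorphism of residue fields respect the second valuation.\<close>

lemma valuation_ring_iso_invariant:
  assumes "h \<in> ring_iso F G" "complete_dvsf_loc F v" "cring F" "dvsf G w" "x \<in> carrier F" "x \<noteq> \<zero>\<^bsub>F\<^esub>"
  shows "w (h x) = v x"
  using valuation_unique[OF assms(2,3) dvsf_pullback[OF assms(1) _ assms(4)] assms(5,6)]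
    complete_dvsf_loc.axioms(1)[OF assms(2)] by (metis comp_apply)

section \<open>Elements with infinite orbit\<close>

lemma ring_iso_funpow: "h \<in> ring_iso F F \<Longrightarrow> h ^^ n \<in> ring_iso F F"
  by (induction n) (auto simp: ring_iso_set_refl[unfolded id_def] id_def intro: ring_iso_set_trans)

context complete_dvsf_loc begin

text \<open>Successive approximation: \<open>step\<close> cancels the leading term of the error z -
  D(s_k), and the corrections form a convergent series. As \<open>D\<close> respects the filtration
  it is continuous, so the limit solves the equation exactly.\<close>

lemma additive_surj_if_graded_surj:
  fixes N :: int
  assumes add: "\<And>x y. \<lbrakk>x \<in> carrier R; y \<in> carrier R\<rbrakk> \<Longrightarrow> D (x \<oplus> y) = D x \<oplus> D y"
    and fil: "\<And>n x. x \<in> fil n \<Longrightarrow> D x \<in> fil n"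
    and step: "\<And>n z. \<lbrakk>N \<le> n; z \<in> fil n\<rbrakk> \<Longrightarrow> \<exists>e \<in> fil n. z \<ominus> D e \<in> fil (n + 1)"
    and z: "z \<in> fil N"
  shows "\<exists>x \<in> fil N. D x = z"
proof -
  have zc: "z \<in> carrier R" using z fil_carrier by blast
  have Dc: "D x \<in> carrier R" if "x \<in> carrier R" for x
    using in_some_fil[OF that] fil fil_carrier by blast
  have D0: "D \<zero> = \<zero>" using add[of \<zero> \<zero>] Dc[of \<zero>] by simp
  have "\<exists>s. \<forall>k. (s k \<in> fil N \<and> z \<ominus> D (s k) \<in> fil (N + int k)) \<and> s (Suc k) \<ominus> s k \<in> fil (N + int k)"
  proof (rule dependent_nat_choice)
    show "\<exists>x. x \<in> fil N \<and> z \<ominus> D x \<in> fil (N + int 0)"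
      using z zc by (intro exI[of _ \<zero>]) (simp add: D0 minus_eq)
  next
    fix x k assume x: "x \<in> fil N \<and> z \<ominus> D x \<in> fil (N + int k)"
    then obtain e where e: "e \<in> fil (N + int k)" "z \<ominus> D x \<ominus> D e \<in> fil (N + int k + 1)"
      using step[of "N + int k" "z \<ominus> D x"] by auto
    have c: "x \<in> carrier R" "e \<in> carrier R" using x e fil_carrier by auto
    have "z \<ominus> D (x \<oplus> e) = z \<ominus> D x \<ominus> D e" using zc c Dc[OF c(1)] Dc[OF c(2)] add[OF c] by algebra
    moreover have "x \<oplus> e \<in> fil N" using x fil_mono[OF e(1), of N] fil_add by simp
    moreover have "x \<oplus> e \<ominus> x = e" using c by algebra
    ultimately show "\<exists>y. (y \<in> fil N \<and> z \<ominus> D y \<in> fil (N + int (Suc k))) \<and> y \<ominus> x \<in> fil (N + int k)"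
      using e by (intro exI[of _ "x \<oplus> e"]) (simp add: ac_simps)
  qed
  then obtain s where s: "\<And>k. s k \<in> fil N" "\<And>k. z \<ominus> D (s k) \<in> fil (N + int k)"
      "\<And>k. s (Suc k) \<ominus> s k \<in> fil (N + int k)" by blast
  have sc: "s k \<in> carrier R" for k using s(1) fil_carrier by blast
  obtain L where L: "L \<in> carrier R" "\<And>k. L \<ominus> s k \<in> fil (N + int k)"
    using fil_limit[OF sc s(3)] by blast
  have "z \<ominus> D L \<in> fil (N + int k)" for k
  proof -
    have c: "L \<ominus> s k \<in> carrier R" using L sc by simp
    have "s k \<oplus> (L \<ominus> s k) = L" using L(1) sc[of k] by algebra
    then have "D L = D (s k) \<oplus> D (L \<ominus> s k)" using add[OF sc c] by metis
    then have "z \<ominus> D L = (z \<ominus> D (s k)) \<ominus> D (L \<ominus> s k)"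
      using zc Dc[OF sc] Dc[OF c] by algebra
    then show ?thesis using fil_minus[OF s(2) fil[OF L(2)]] by simp
  qed
  then have "z = D L" using zc Dc L(1) by (intro eq_if_fil[of _ _ N]) auto
  moreover have "L \<in> fil N" using fil_minus_cancel[OF _ s(1) L(1), of 0] L(2)[of 0] by simp
  ultimately show ?thesis by blast
qed

text \<open>A Baire category argument: the kernels of the maps $D_n$ are closed subgroups
  with empty interior, so they do not cover the complete space \<open>carrier R\<close>.\<close>
lemma ex_outside_kernels:
  fixes D :: "nat \<Rightarrow> 'a \<Rightarrow> 'a"
  assumes add: "\<And>n x y. \<lbrakk>x \<in> carrier R; y \<in> carrier R\<rbrakk> \<Longrightarrow> D n (x \<oplus> y) = D n x \<oplus> D n y"
    and fil: "\<And>n k x. x \<in> fil k \<Longrightarrow> D n x \<in> fil k"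
    and nz: "\<And>n k. \<exists>x \<in> fil k. D n x \<noteq> \<zero>"
  shows "\<exists>c \<in> carrier R. \<forall>n. D n c \<noteq> \<zero>"
proof -
  have Dc: "D n x \<in> carrier R" if "x \<in> carrier R" for x n
    using in_some_fil[OF that] fil fil_carrier by blast
  \<comment> \<open>Being outside \<open>fil r\<close> is stable on balls: changing the argument by
    an element of \<open>fil r\<close> changes the value of \<open>D n\<close> only within
    \<open>fil r\<close>.\<close>
  have pert: "D n y \<notin> fil r" if "D n x \<notin> fil r" "y \<ominus> x \<in> fil r" "x \<in> carrier R" "y \<in> carrier R" for n x y r
  proof
    assume y: "D n y \<in> fil r"
    have "x \<oplus> (y \<ominus> x) = y" using that(3,4) by algebra
    then have "D n y = D n x \<oplus> D n (y \<ominus> x)" using add[of x "y \<ominus> x" n] that(3,4) by simp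
    then have "D n x = D n y \<ominus> D n (y \<ominus> x)" using Dc[of x n] Dc[of "y \<ominus> x" n] that(3,4) by algebra
    with that(1) show False using fil_minus[OF y fil[OF that(2)]] by metis
  qed
  \<comment> \<open>A pair is the centre and the exponent of a ball. In stage \<open>n\<close> the
    first \<open>n\<close> maps avoid \<open>fil\<close> of the exponent at the centre, hence by
    \<open>pert\<close> on the whole ball; each new centre lies in the previous ball.\<close>
  have "\<exists>f. \<forall>n. (fst (f n) \<in> carrier R \<and> (\<forall>i<n. D i (fst (f n)) \<notin> fil (snd (f n)))) \<and>
      (fst (f (Suc n)) \<ominus> fst (f n) \<in> fil (snd (f n)) \<and> snd (f n) < snd (f (Suc n)))"
  proof (rule dependent_nat_choice)
    show "\<exists>p. fst p \<in> carrier R \<and> (\<forall>i<0. D i (fst p) \<notin> fil (snd p))"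
      by (intro exI[of _ "(\<zero>, 0)"]) simp
  next
    fix p n assume p: "fst p \<in> carrier R \<and> (\<forall>i<n. D i (fst p) \<notin> fil (snd p))"
    obtain c r where cr: "p = (c, r)" by (cases p)
    \<comment> \<open>If \<open>D n\<close> vanishes at the centre, moving by an element of the ball
      \<open>fil r\<close> outside its kernel makes it nonzero.\<close>
    have "\<exists>x \<in> fil r. D n (c \<oplus> x) \<noteq> \<zero>"
    proof (cases "D n c = \<zero>")
      case True
      obtain x where "x \<in> fil r" "D n x \<noteq> \<zero>" using nz by blast
      then show ?thesis using add[of c x n] True Dc fil_carrier p cr by (intro bexI[of _ x]) auto
    next
      case False
      then show ?thesis using p cr by (intro bexI[of _ \<zero>]) auto
    qed
    then obtain x where x: "x \<in> fil r" "D n (c \<oplus> x) \<noteq> \<zero>" by blast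
    have c: "c \<in> carrier R" "x \<in> carrier R" using p cr x fil_carrier by auto
    \<comment> \<open>Larger than \<open>r\<close>, so that the balls shrink, and larger than the
      value of \<open>D n\<close> at the new centre, so that this value stays outside
      \<open>fil r'\<close>.\<close>
    define r' where "r' = max (r + 1) (v (D n (c \<oplus> x)) + 1)"
    have d: "(c \<oplus> x) \<ominus> c = x" using c by algebra
    have "D i (c \<oplus> x) \<notin> fil r'" if "i < Suc n" for i
    proof (cases "i = n")
      case True
      then show ?thesis using x by (auto simp: r'_def fil_iff)
    next
      case False
      then have "D i (c \<oplus> x) \<notin> fil r" using pert[of i c r "c \<oplus> x"] d x c p cr that by auto
      then show ?thesis using fil_mono[of _ r' r] by (auto simp: r'_def)
    qed
    then show "\<exists>q. (fst q \<in> carrier R \<and> (\<forall>i<Suc n. D i (fst q) \<notin> fil (snd q))) \<and>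
        fst q \<ominus> fst p \<in> fil (snd p) \<and> snd p < snd q"
      using c d x cr by (intro exI[of _ "(c \<oplus> x, r')"]) (auto simp: r'_def)
  qed
  then obtain f where f: "\<And>n. fst (f n) \<in> carrier R"
    "\<And>n i. i < n \<Longrightarrow> D i (fst (f n)) \<notin> fil (snd (f n))"
    "\<And>n. fst (f (Suc n)) \<ominus> fst (f n) \<in> fil (snd (f n))" "\<And>n. snd (f n) < snd (f (Suc n))"
    by blast
  define c where "c = fst \<circ> f"
  define r where "r = snd \<circ> f"
  have c: "c n \<in> carrier R" "c (Suc n) \<ominus> c n \<in> fil (r n)" "r n < r (Suc n)"
    "i < n \<Longrightarrow> D i (c n) \<notin> fil (r n)" for n i
    using f by (auto simp: c_def r_def)
  have r: "r n + int k \<le> r (n + k)" for n k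
    by (induction k) (use c(3) in \<open>auto intro: order.trans simp: zless_imp_add1_zle less_imp_le\<close>, smt (verit) c(3))
  have "c (Suc (n + k)) \<ominus> c (n + k) \<in> fil (r n + int k)" for n k
    using fil_mono[OF c(2) r] .
  then have lim: "\<exists>L \<in> carrier R. \<forall>k. L \<ominus> c (n + k) \<in> fil (r n + int k)" for n
    using fil_limit[of "\<lambda>k. c (n + k)" "r n"] c(1) by (metis add_Suc_right)
  then obtain L where L: "L \<in> carrier R" "\<And>k. L \<ominus> c k \<in> fil (r 0 + int k)" by (metis add_0)
  \<comment> \<open>The limit taken from stage 0 comes only with the rate
    \<open>r 0 + int k\<close>. The limit of the tail from stage \<open>n\<close> comes with the
    rate \<open>r n\<close>, and the two limits coincide.\<close>
  have Ln: "L \<ominus> c n \<in> fil (r n)" for n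
  proof -
    obtain M where M: "M \<in> carrier R" "\<And>k. M \<ominus> c (n + k) \<in> fil (r n + int k)" using lim by blast
    have "M \<ominus> L \<in> fil (r 0 + int k)" for k
    proof -
      have "M \<ominus> c (n + k) \<in> fil (r 0 + int k)"
        using fil_mono[OF M(2)[of k]] r[of 0 n] by simp
      moreover have "L \<ominus> c (n + k) \<in> fil (r 0 + int k)" using fil_mono[OF L(2)[of "n + k"]] by simp
      ultimately show ?thesis using fil_minus_trans[OF _ fil_minus_swap[OF _ L(1) c(1)] M(1) c(1) L(1)] by blast
    qed
    then have "M = L" using M(1) L(1) by (intro eq_if_fil[of _ _ "r 0"]) auto
    then show ?thesis using M(2)[of 0] by simp
  qed
  have "D n L \<noteq> \<zero>" for n
    using pert[OF c(4)[of n "Suc n"] Ln c(1) L(1)] by (metis fil_zero lessI)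
  then show ?thesis using L by blast
qed

end

lemma nonperiodic_element:
  assumes "complete_dvsf_loc F w" "cring F" "\<sigma> \<in> ring_iso F F" "aut_nonperiodic F \<sigma>"
  obtains c where "c \<in> carrier F" "\<And>n. 1 \<le> n \<Longrightarrow> (\<sigma> ^^ n) c \<noteq> c"
proof -
  interpret cring F by fact
  interpret W: complete_dvsf_loc F w by fact
  obtain t where "uniformized_dvsf F w t" by (rule W.ex_uniformizer)
  then interpret W: uniformized_dvsf F w t .
  note iso = ring_iso_funpow[OF assms(3)]
  note hom = ring_iso_memE[OF iso]
  have dv: "dvsf F w" by unfold_locales
  \<comment> \<open>Continuity of the powers of \<sigma>, by invariance of the valuation.\<close>
  have sfil: "(\<sigma> ^^ n) x \<in> W.fil k" if "x \<in> W.fil k" for n k x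
  proof (cases "x = \<zero>\<^bsub>F\<^esub>")
    case True
    have "(\<sigma> ^^ n) \<zero>\<^bsub>F\<^esub> = \<zero>\<^bsub>F\<^esub>"
      using ring_hom_zero[of "\<sigma> ^^ n" F F] iso[of n] ring_axioms by (simp add: ring_iso_def)
    then show ?thesis using True by simp
  next
    case False
    then show ?thesis using that valuation_ring_iso_invariant[OF iso assms(1,2) dv] hom(1)
      by (auto simp: W.fil_iff)
  qed
  \<comment> \<open>The kernel is the fixed field of a power of \<sigma>; the shift by one leaves
    out the power zero.\<close>
  define D where "D n x = (\<sigma> ^^ Suc n) x \<ominus>\<^bsub>F\<^esub> x" for n x
  have "\<exists>c \<in> carrier F. \<forall>n. D n c \<noteq> \<zero>\<^bsub>F\<^esub>"
  proof (rule W.ex_outside_kernels)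
    fix n x y assume "x \<in> carrier F" "y \<in> carrier F"
    then show "D n (x \<oplus>\<^bsub>F\<^esub> y) = D n x \<oplus>\<^bsub>F\<^esub> D n y"
      unfolding D_def hom(3)[OF \<open>x \<in> carrier F\<close> \<open>y \<in> carrier F\<close>]
      using hom(1)[of x "Suc n"] hom(1)[of y "Suc n"] by algebra
  next
    fix n k x assume "x \<in> W.fil k"
    then show "D n x \<in> W.fil k" unfolding D_def by (intro W.fil_minus sfil)
  next
    fix n k
    obtain z where z: "z \<in> carrier F" "(\<sigma> ^^ Suc n) z \<noteq> z"
      using assms(4)[unfolded aut_nonperiodic_def, rule_format, of "Suc n"] by auto
    obtain m where m: "z \<in> W.fil m" using W.in_some_fil z by blast
    \<comment> \<open>The exponent is chosen such that both \<open>p\<close> and its product with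
      \<open>z\<close> lie in \<open>fil k\<close>.\<close>
    define p where "p = W.T (max k (k - m))"
    have p: "p \<in> W.fil k" "p \<in> W.fil (k - m)" by (simp_all add: p_def W.T_fil)
    have pz: "p \<otimes>\<^bsub>F\<^esub> z \<in> W.fil k" using W.fil_mult[OF p(2) m] by simp
    have pc: "p \<in> carrier F" "p \<noteq> \<zero>\<^bsub>F\<^esub>" by (simp_all add: p_def)
    \<comment> \<open>A fixed field containing \<open>p\<close> and p z would contain their quotient
      \<open>z\<close>; so a proper subfield contains no ball.\<close>
    have "(\<sigma> ^^ Suc n) p \<noteq> p \<or> (\<sigma> ^^ Suc n) (p \<otimes>\<^bsub>F\<^esub> z) \<noteq> p \<otimes>\<^bsub>F\<^esub> z"
    proof (rule ccontr)
      assume "\<not> ?thesis"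
      then have "p \<otimes>\<^bsub>F\<^esub> (\<sigma> ^^ Suc n) z = p \<otimes>\<^bsub>F\<^esub> z" using hom(2)[OF pc(1) z(1), of "Suc n"] by simp
      then show False
        using W.mult_left_cancel[OF pc hom(1)[OF z(1), of "Suc n"] z(1)] z(2) by blast
    qed
    then show "\<exists>x \<in> W.fil k. D n x \<noteq> \<zero>\<^bsub>F\<^esub>"
      using p(1) pz hom(1)[of _ "Suc n"] W.fil_carrier by (auto simp: D_def simp del: funpow.simps)
  qed
  then obtain c where c: "c \<in> carrier F" "\<And>n. D n c \<noteq> \<zero>\<^bsub>F\<^esub>" by blast
  have "(\<sigma> ^^ n) c \<noteq> c" if "1 \<le> n" for n
    using c(2)[of "n - 1"] that c(1) by (auto simp: D_def minus_eq r_neg simp del: funpow.simps)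
  with c(1) that show ?thesis by blast
qed

section \<open>Commuting lifts and the section\<close>

lemma (in dvsf) conj_fil:
  assumes "s \<in> carrier R" "s \<noteq> \<zero>" "x \<in> fil n" shows "s \<otimes> x \<otimes> inv s \<in> fil n"
  using assms by (cases "x = \<zero>") (auto simp: fil_iff val_mult val_inv)

locale comm_residue_dvsf = complete_dvsf_loc +
  assumes comm_K1: "cring K1"
begin

sublocale K1: cring K1 by (rule comm_K1)

abbreviation \<alpha> where "\<alpha> \<equiv> canonical_aut R v"

text \<open>Replaces the prime element and the lift picked in \<open>canonical_aut\<close> by
  arbitrary ones. Two prime elements differ by a unit, and conjugation by a unit acts trivially on a
  commutative residue field; two lifts differ by an element of the maximal ideal, which conjugation
  preserves.\<close>

lemma canonical_aut_res:
  assumes s: "s \<in> carrier R" "s \<noteq> \<zero>" "v s = 1" and y: "y \<in> fil 0"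
  shows "\<alpha> (res y) = res (s \<otimes> y \<otimes> inv s)"
proof -
  define s0 where "s0 = (SOME t. t \<in> carrier R \<and> t \<noteq> \<zero> \<and> v t = 1)"
  define y0 where "y0 = (SOME z. z \<in> valuation_ring R v \<and> residue_map R v z = res y)"
  have s0: "s0 \<in> carrier R" "s0 \<noteq> \<zero>" "v s0 = 1"
    using someI[of "\<lambda>t. t \<in> carrier R \<and> t \<noteq> \<zero> \<and> v t = 1" s] s by (auto simp: s0_def)
  have y0: "y0 \<in> fil 0" "res y0 = res y"
    using someI[of "\<lambda>z. z \<in> valuation_ring R v \<and> residue_map R v z = res y" y] y
    by (auto simp: y0_def valuation_ring_eq)
  have c: "y \<in> carrier R" "y0 \<in> carrier R" using y y0 fil_carrier by auto
  define u where "u = s \<otimes> inv s0"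
  have u: "u \<in> carrier R" "u \<noteq> \<zero>" "u \<in> fil 0" "inv u \<in> fil 0" "u \<otimes> s0 = s"
    using s s0 by (auto simp: u_def fil_iff val_mult val_inv m_assoc)
  have s': "inv s0 = inv s \<otimes> u"
    using s s0 by (simp add: u_def m_assoc flip: m_assoc[of "inv s" s "inv s0"])
  have *: "s0 \<otimes> z \<otimes> inv s0 \<in> fil n" if "z \<in> fil n" for z n using conj_fil s0 that by blast
  have **: "s \<otimes> z \<otimes> inv s \<in> fil n" if "z \<in> fil n" for z n using conj_fil s that by blast
  \<comment> \<open>Written with \<open>u\<close> on opposite sides, so that after taking residues
    it can be commuted and cancelled.\<close>
  have "u \<otimes> (s0 \<otimes> y0 \<otimes> inv s0) = (u \<otimes> s0) \<otimes> y0 \<otimes> inv s \<otimes> u"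
    unfolding s' using u(1-4) s s0 c by (simp add: m_assoc)
  also have "\<dots> = (s \<otimes> y0 \<otimes> inv s) \<otimes> u" using u s c by simp
  finally have "res u \<otimes>\<^bsub>K1\<^esub> res (s0 \<otimes> y0 \<otimes> inv s0) = res (s \<otimes> y0 \<otimes> inv s) \<otimes>\<^bsub>K1\<^esub> res u"
    using u y0 * ** by (metis res_mult)
  then have "res u \<otimes>\<^bsub>K1\<^esub> res (s0 \<otimes> y0 \<otimes> inv s0) = res u \<otimes>\<^bsub>K1\<^esub> res (s \<otimes> y0 \<otimes> inv s)"
    using u y0 ** K1.m_comm by simp
  then have "res (inv u) \<otimes>\<^bsub>K1\<^esub> res u \<otimes>\<^bsub>K1\<^esub> res (s0 \<otimes> y0 \<otimes> inv s0)
    = res (inv u) \<otimes>\<^bsub>K1\<^esub> res u \<otimes>\<^bsub>K1\<^esub> res (s \<otimes> y0 \<otimes> inv s)"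
    using u y0 * ** by (simp add: K1.m_assoc)
  moreover have "res (inv u) \<otimes>\<^bsub>K1\<^esub> res u = \<one>\<^bsub>K1\<^esub>" using u by (simp add: res_one flip: res_mult)
  ultimately have "res (s0 \<otimes> y0 \<otimes> inv s0) = res (s \<otimes> y0 \<otimes> inv s)" using * ** y0 by simp
  moreover have "res (s \<otimes> y0 \<otimes> inv s) = res (s \<otimes> y \<otimes> inv s)"
  proof -
    have "s \<otimes> y0 \<otimes> inv s \<ominus> s \<otimes> y \<otimes> inv s = s \<otimes> (y0 \<ominus> y) \<otimes> inv s"
      using s c inv_nonzero_closed[OF s(1,2)] by algebra
    moreover have "y0 \<ominus> y \<in> fil 1" using y0 y res_eq_iff by blast
    ultimately show ?thesis using ** res_eq_iff y0(1) y by simp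
  qed
  ultimately show ?thesis
    by (simp add: canonical_aut_def flip: s0_def y0_def)
qed

text \<open>Conjugation by a prime element preserves values exactly, whence injectivity; conjugation
  by its inverse provides preimages.\<close>

lemma canonical_aut_iso: "\<alpha> \<in> ring_iso K1 K1"
proof -
  obtain t where "uniformized_dvsf R v t" by (rule ex_uniformizer)
  then interpret uniformized_dvsf R v t .
  have ti: "inv t \<in> carrier R" by simp
  note res = canonical_aut_res[OF t_carrier t_nonzero val_t]
  have cf: "t \<otimes> y \<otimes> inv t \<in> fil n" if "y \<in> fil n" for y n using conj_fil that by simp
  show ?thesis
  proof (rule ring_iso_memI)
    fix Z Y assume "Z \<in> carrier K1" "Y \<in> carrier K1"
    then obtain x y where x: "x \<in> fil 0" "Z = res x" and y: "y \<in> fil 0" "Y = res y"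
      using res_surj by metis
    have c: "x \<in> carrier R" "y \<in> carrier R" using x y fil_carrier by auto
    show "\<alpha> Z \<in> carrier K1" using x res cf by simp
    have "t \<otimes> x \<otimes> inv t \<oplus> t \<otimes> y \<otimes> inv t = t \<otimes> (x \<oplus> y) \<otimes> inv t" using c t_carrier ti by algebra
    then show "\<alpha> (Z \<oplus>\<^bsub>K1\<^esub> Y) = \<alpha> Z \<oplus>\<^bsub>K1\<^esub> \<alpha> Y"
      using x y res cf fil_add by (simp flip: res_add)
    have "t \<otimes> x \<otimes> inv t \<otimes> (t \<otimes> y \<otimes> inv t) = t \<otimes> (x \<otimes> y) \<otimes> inv t"
      using c by (simp add: m_assoc, simp flip: m_assoc[of "inv t" t])
    then show "\<alpha> (Z \<otimes>\<^bsub>K1\<^esub> Y) = \<alpha> Z \<otimes>\<^bsub>K1\<^esub> \<alpha> Y"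
      using x y res cf fil_mult_l by (simp flip: res_mult)
  next
    show "\<alpha> \<one>\<^bsub>K1\<^esub> = \<one>\<^bsub>K1\<^esub>" using res[of \<one>] by (simp add: res_one[symmetric])
  next
    show "bij_betw \<alpha> (carrier K1) (carrier K1)"
    proof (rule bij_betw_imageI)
      show "inj_on \<alpha> (carrier K1)"
      proof (rule inj_onI)
        fix Z Y assume "Z \<in> carrier K1" "Y \<in> carrier K1" and e: "\<alpha> Z = \<alpha> Y"
        then obtain x y where x: "x \<in> fil 0" "Z = res x" and y: "y \<in> fil 0" "Y = res y"
          using res_surj by metis
        have c: "x \<in> carrier R" "y \<in> carrier R" using x y fil_carrier by auto
        have "t \<otimes> x \<otimes> inv t \<ominus> t \<otimes> y \<otimes> inv t \<in> fil 1"
          using e x y res cf by (simp add: res_eq_iff)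
        moreover have "t \<otimes> x \<otimes> inv t \<ominus> t \<otimes> y \<otimes> inv t = t \<otimes> (x \<ominus> y) \<otimes> inv t"
          using c t_carrier ti by algebra
        ultimately have "x \<ominus> y \<in> fil 1"
          using c by (cases "x \<ominus> y = \<zero>") (auto simp: fil_iff val_mult val_inv)
        then show "Z = Y" using x y res_eq_iff by blast
      qed
      have "\<exists>Z \<in> carrier K1. \<alpha> Z = Y" if Y: "Y \<in> carrier K1" for Y
      proof -
        obtain y where y: "y \<in> fil 0" "Y = res y" using res_surj Y by metis
        have c: "y \<in> carrier R" using y fil_carrier by auto
        have f: "inv t \<otimes> y \<otimes> t \<in> fil 0"
          using y by (cases "y = \<zero>") (auto simp: fil_iff val_mult val_inv)
        have "t \<otimes> (inv t \<otimes> y \<otimes> t) \<otimes> inv t = y" using c by (simp add: m_assoc, simp flip: m_assoc[of t "inv t"])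
        then have "\<alpha> (res (inv t \<otimes> y \<otimes> t)) = Y" using res[OF f] y by simp
        then show ?thesis using f by (intro bexI[of _ "res (inv t \<otimes> y \<otimes> t)"]) simp_all
      qed
      moreover have "\<alpha> Z \<in> carrier K1" if "Z \<in> carrier K1" for Z
        using res_surj[OF that] res cf by auto
      ultimately show "\<alpha> ` carrier K1 = carrier K1" by blast
    qed
  qed
qed

lemmas canonical_aut_pow = ring_iso_memE[OF ring_iso_funpow[OF canonical_aut_iso]]
lemmas canonical_aut = ring_iso_memE[OF canonical_aut_iso]

end

section \<open>The equation x a - b x = z, degree by degree\<close>

locale comm_residue_uniformized = comm_residue_dvsf + uniformized_dvsf
begin

text \<open>Each factor \<open>t\<close> that moves past a lift applies \<alpha> once to its
  residue.\<close>

lemma T_commute: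
  assumes "y \<in> fil 0"
  shows "\<exists>y' \<in> fil 0. T (int n) \<otimes> y = y' \<otimes> T (int n) \<and> res y' = (\<alpha> ^^ n) (res y)"
proof (induction n)
  case 0
  then show ?case using assms fil_carrier by auto
next
  case (Suc n)
  then obtain y' where y': "y' \<in> fil 0" "T (int n) \<otimes> y = y' \<otimes> T (int n)" "res y' = (\<alpha> ^^ n) (res y)" by blast
  have c: "y \<in> carrier R" "y' \<in> carrier R" using assms y' fil_carrier by auto
  have T: "T (int (Suc n)) = t \<otimes> T (int n)" using T_add[of 1 "int n"] by simp
  have "T (int (Suc n)) \<otimes> y = t \<otimes> (y' \<otimes> T (int n))"
    unfolding T using c by (simp add: m_assoc y'(2))
  also have "\<dots> = (t \<otimes> y' \<otimes> inv t) \<otimes> T (int (Suc n))"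
    unfolding T using c by (simp add: m_assoc, simp flip: m_assoc[of "inv t" t])
  finally have "T (int (Suc n)) \<otimes> y = (t \<otimes> y' \<otimes> inv t) \<otimes> T (int (Suc n))" .
  moreover have "res (t \<otimes> y' \<otimes> inv t) = (\<alpha> ^^ Suc n) (res y)"
    using canonical_aut_res[OF t_carrier t_nonzero val_t y'(1)] y'(3) by simp
  ultimately show ?case using conj_fil[OF t_carrier t_nonzero y'(1)] by blast
qed

text \<open>On the graded piece of degree $n$ the map $x \mapsto xa - bx$ is multiplication by
  $\alpha^n(\bar a) - \bar b$.\<close>
lemma sylvester_graded:
  assumes "a \<in> fil 0" "b \<in> fil 0" "u \<in> fil 0"
  obtains w where "w \<in> fil 0" "(u \<otimes> T (int n)) \<otimes> a \<ominus> b \<otimes> (u \<otimes> T (int n)) = w \<otimes> T (int n)"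
    "res w = res u \<otimes>\<^bsub>K1\<^esub> ((\<alpha> ^^ n) (res a) \<ominus>\<^bsub>K1\<^esub> res b)"
proof -
  obtain a' where a': "a' \<in> fil 0" "T (int n) \<otimes> a = a' \<otimes> T (int n)" "res a' = (\<alpha> ^^ n) (res a)"
    using T_commute[OF assms(1)] by blast
  have c: "a \<in> carrier R" "b \<in> carrier R" "u \<in> carrier R" "a' \<in> carrier R"
    using assms a' fil_carrier by auto
  have "(u \<otimes> T (int n)) \<otimes> a = (u \<otimes> a') \<otimes> T (int n)" using c by (simp add: m_assoc a'(2))
  then have "(u \<otimes> T (int n)) \<otimes> a \<ominus> b \<otimes> (u \<otimes> T (int n)) = (u \<otimes> a') \<otimes> T (int n) \<ominus> b \<otimes> (u \<otimes> T (int n))"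
    by simp
  also have "\<dots> = (u \<otimes> a' \<ominus> b \<otimes> u) \<otimes> T (int n)" using c T_carrier[of "int n"] by algebra
  finally have 1: "(u \<otimes> T (int n)) \<otimes> a \<ominus> b \<otimes> (u \<otimes> T (int n)) = (u \<otimes> a' \<ominus> b \<otimes> u) \<otimes> T (int n)" .
  have "res (u \<otimes> a' \<ominus> b \<otimes> u) = res u \<otimes>\<^bsub>K1\<^esub> res a' \<ominus>\<^bsub>K1\<^esub> res b \<otimes>\<^bsub>K1\<^esub> res u"
    using assms a'(1) by (simp add: res_minus res_mult fil_mult_l)
  also have "\<dots> = res u \<otimes>\<^bsub>K1\<^esub> (res a' \<ominus>\<^bsub>K1\<^esub> res b)"
    using assms(2,3)[THEN res_closed] a'(1)[THEN res_closed] by algebra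
  finally show ?thesis using that[OF _ 1] assms a' by (simp add: fil_minus fil_mult_l)
qed

end

locale two_dim_comm = comm_residue_dvsf +
  fixes w :: "'a set \<Rightarrow> int"
  assumes complete_K1: "complete_dvsf_loc K1 w"
begin

sublocale K1: complete_dvsf_loc K1 w by (rule complete_K1)

text \<open>Write a nonzero x as u t^n with n = v(x) and u a unit. In degree n, x a - b x has the
  coefficient res(u) (\<alpha>^n(res a) - res b), a product of nonzero elements of a field.\<close>

lemma sylvester_inj:
  assumes a: "a \<in> fil 0" "b \<in> fil 0" and ne: "\<And>n. N \<le> n \<Longrightarrow> (\<alpha> ^^ n) (res a) \<noteq> res b"
    and x: "x \<in> fil (int N)" "x \<otimes> a = b \<otimes> x"
  shows "x = \<zero>"
proof (rule ccontr)
  assume nz: "x \<noteq> \<zero>"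
  obtain t where "uniformized_dvsf R v t" by (rule ex_uniformizer)
  then interpret uniformized_dvsf R v t .
  interpret comm_residue_uniformized R v t by unfold_locales
  have xc: "x \<in> carrier R" using x fil_carrier by blast
  define n where "n = nat (v x)"
  have n: "N \<le> n" "v x = int n" using x nz by (auto simp: n_def fil_iff)
  have "x \<in> fil (int n)" using n xc by (simp add: fil_iff)
  then obtain u where u: "u \<in> fil 0" "x = u \<otimes> T (int n)" by (rule fil_divide)
  have uc: "u \<in> carrier R" "u \<noteq> \<zero>" using u nz fil_carrier by auto
  then have "v u = 0" using n u by (simp add: val_mult)
  then have u1: "res u \<noteq> \<zero>\<^bsub>K1\<^esub>" using u(1) uc by (simp add: res_eq_zero_iff fil_iff)
  obtain z where z: "z \<in> fil 0" "x \<otimes> a \<ominus> b \<otimes> x = z \<otimes> T (int n)"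
    "res z = res u \<otimes>\<^bsub>K1\<^esub> ((\<alpha> ^^ n) (res a) \<ominus>\<^bsub>K1\<^esub> res b)"
    using sylvester_graded[OF a u(1), of n] u(2) by metis
  have "z \<otimes> T (int n) = \<zero>"
    using z(2) x(2) xc a(2) fil_carrier by (simp add: minus_eq r_neg)
  then have "z = \<zero>" using z(1) fil_carrier by simp
  then have "(\<alpha> ^^ n) (res a) \<ominus>\<^bsub>K1\<^esub> res b = \<zero>\<^bsub>K1\<^esub>"
    using z(3) u1 K1.mult_eq_zero_iff[OF res_closed[OF u(1)]] a canonical_aut_pow(1)
    by (metis K1.minus_closed res_closed res_zero)
  then show False using ne[OF n(1)] a canonical_aut_pow(1) by (simp add: K1.r_right_minus_eq)
qed

text \<open>The same factor can be divided out in every degree from \<open>N\<close> on, which is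
  the graded surjectivity needed for successive approximation.\<close>

lemma sylvester_surj:
  assumes a: "a \<in> fil 0" "b \<in> fil 0" and ne: "\<And>n. N \<le> n \<Longrightarrow> (\<alpha> ^^ n) (res a) \<noteq> res b"
    and z: "z \<in> fil (int N)"
  shows "\<exists>x \<in> fil (int N). x \<otimes> a \<ominus> b \<otimes> x = z"
proof -
  obtain t where "uniformized_dvsf R v t" by (rule ex_uniformizer)
  then interpret uniformized_dvsf R v t .
  interpret comm_residue_uniformized R v t by unfold_locales
  have c: "a \<in> carrier R" "b \<in> carrier R" using a fil_carrier by auto
  show ?thesis
  proof (rule additive_surj_if_graded_surj[OF _ _ _ z])
    fix x y assume "x \<in> carrier R" "y \<in> carrier R"
    then show "(x \<oplus> y) \<otimes> a \<ominus> b \<otimes> (x \<oplus> y) = (x \<otimes> a \<ominus> b \<otimes> x) \<oplus> (y \<otimes> a \<ominus> b \<otimes> y)"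
      using c by algebra
  next
    fix n x assume "x \<in> fil n" then show "x \<otimes> a \<ominus> b \<otimes> x \<in> fil n"
      using a by (simp add: fil_minus fil_mult_l fil_mult_r)
  next
    fix m z assume m: "int N \<le> m" and z: "z \<in> fil m"
    define n where "n = nat m"
    have n: "N \<le> n" "m = int n" using m by (auto simp: n_def)
    obtain y where y: "y \<in> fil 0" "z = y \<otimes> T (int n)" using fil_divide[OF z] n by metis
    define d where "d = (\<alpha> ^^ n) (res a) \<ominus>\<^bsub>K1\<^esub> res b"
    have d: "d \<in> carrier K1" "d \<noteq> \<zero>\<^bsub>K1\<^esub>"
      using ne[OF n(1)] a canonical_aut_pow(1) by (auto simp: d_def K1.r_right_minus_eq)
    then have d': "inv\<^bsub>K1\<^esub> d \<in> carrier K1" by simp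
    \<comment> \<open>Solves the equation on the graded piece, where it reads res(u) d =
      res(y).\<close>
    obtain u where u: "u \<in> fil 0" "res u = res y \<otimes>\<^bsub>K1\<^esub> inv\<^bsub>K1\<^esub> d"
      using res_surj[of "res y \<otimes>\<^bsub>K1\<^esub> inv\<^bsub>K1\<^esub> d"] y d' by auto
    define e where "e = u \<otimes> T (int n)"
    have e: "e \<in> fil (int n)" unfolding e_def using fil_mult_l[OF u(1) T_fil] by simp
    obtain w where w: "w \<in> fil 0" "e \<otimes> a \<ominus> b \<otimes> e = w \<otimes> T (int n)" "res w = res u \<otimes>\<^bsub>K1\<^esub> d"
      using sylvester_graded[OF a u(1), of n] unfolding d_def[symmetric] e_def by metis
    have "res w = res y" using w(3) u(2) d d' y by (simp add: K1.m_assoc)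
    then have 1: "y \<ominus> w \<in> fil 1" using res_eq_iff[OF y(1) w(1)] by simp
    have "z \<ominus> (e \<otimes> a \<ominus> b \<otimes> e) = (y \<ominus> w) \<otimes> T (int n)"
      unfolding w(2) y(2) using y(1)[THEN fil_carrier] w(1)[THEN fil_carrier] T_carrier[of "int n"] by algebra
    also have "\<dots> \<in> fil (1 + int n)" using fil_mult[OF 1 T_fil] by simp
    finally show "\<exists>e\<in>fil m. z \<ominus> (e \<otimes> a \<ominus> b \<otimes> e) \<in> fil (m + 1)" using e n by (auto simp: add.commute)
  qed
qed

text \<open>Start with any lift y. Its commutator with a lies in the maximal ideal because K_1 is
  commutative, so it equals x a - a x for some x in \<open>fil 1\<close>, and y - x commutes with a.
  Two such lifts differ by a commuting element of \<open>fil 1\<close>, which is zero by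
  injectivity.\<close>

lemma unique_commuting_lift:
  assumes a: "a \<in> fil 0" and ne: "\<And>n. 1 \<le> n \<Longrightarrow> (\<alpha> ^^ n) (res a) \<noteq> res a" and Y: "Y \<in> carrier K1"
  shows "\<exists>!x. x \<in> fil 0 \<and> res x = Y \<and> x \<otimes> a = a \<otimes> x"
proof -
  have ac: "a \<in> carrier R" using a fil_carrier by blast
  obtain y where y: "y \<in> fil 0" "res y = Y" using res_surj[OF Y] by blast
  have yc: "y \<in> carrier R" using y fil_carrier by blast
  have "res (y \<otimes> a) = res (a \<otimes> y)"
    using K1.m_comm[OF res_closed[OF y(1)] res_closed[OF a]] y(1) a by (simp add: res_mult)
  then have "y \<otimes> a \<ominus> a \<otimes> y \<in> fil 1" using y a by (simp add: res_eq_iff fil_mult_l)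
  then obtain x where x: "x \<in> fil 1" "x \<otimes> a \<ominus> a \<otimes> x = y \<otimes> a \<ominus> a \<otimes> y"
    using sylvester_surj[OF a a, of 1] ne by auto
  have xc: "x \<in> carrier R" and x0: "x \<in> fil 0" using x fil_carrier fil_mono[of x 1 0] by auto
  have "(y \<ominus> x) \<otimes> a \<ominus> a \<otimes> (y \<ominus> x) = (y \<otimes> a \<ominus> a \<otimes> y) \<ominus> (x \<otimes> a \<ominus> a \<otimes> x)"
    using xc yc ac by algebra
  also have "\<dots> = \<zero>" using x yc ac by (simp add: minus_eq r_neg)
  finally have 1: "(y \<ominus> x) \<otimes> a = a \<otimes> (y \<ominus> x)" using xc yc ac by (simp add: r_right_minus_eq)
  have 2: "y \<ominus> x \<in> fil 0" using y(1) x0 fil_minus by blast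
  have "y \<ominus> (y \<ominus> x) = x" using yc xc by algebra
  then have 3: "res (y \<ominus> x) = Y" using res_eq_iff[OF y(1) 2] y(2) x(1) by simp
  show ?thesis
  proof (rule ex1I[of _ "y \<ominus> x"])
    show "y \<ominus> x \<in> fil 0 \<and> res (y \<ominus> x) = Y \<and> (y \<ominus> x) \<otimes> a = a \<otimes> (y \<ominus> x)" using 1 2 3 by simp
  next
    fix z assume z: "z \<in> fil 0 \<and> res z = Y \<and> z \<otimes> a = a \<otimes> z"
    have zc: "z \<in> carrier R" using z fil_carrier by blast
    define q where "q = y \<ominus> x"
    have q: "q \<in> fil 0" "res q = Y" "q \<otimes> a = a \<otimes> q" "q \<in> carrier R" using 1 2 3 fil_carrier by (auto simp: q_def)
    have "z \<ominus> q \<in> fil (int 1)" using z q(1,2) res_eq_iff[of z q] by auto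
    moreover have "(z \<ominus> q) \<otimes> a = a \<otimes> (z \<ominus> q)"
      using z q zc ac by (simp add: minus_eq l_distr r_distr l_minus r_minus)
    ultimately have "z \<ominus> q = \<zero>" by (intro sylvester_inj[OF a a, of 1]) (use ne in auto)
    then show "z = y \<ominus> x" using zc q by (simp add: r_right_minus_eq flip: q_def)
  qed
qed

theorem ex_section:
  assumes np: "aut_nonperiodic K1 \<alpha>"
  obtains s t where "s \<in> ring_hom K1 (R\<lparr>carrier := valuation_ring R v\<rparr>)"
    "\<And>Y. Y \<in> carrier K1 \<Longrightarrow> res (s Y) = Y"
    "uniformized_dvsf R v t" "\<And>Y. Y \<in> carrier K1 \<Longrightarrow> t \<otimes> s Y = s (\<alpha> Y) \<otimes> t"
proof -
  obtain c where c: "c \<in> carrier K1" "\<And>n. 1 \<le> n \<Longrightarrow> (\<alpha> ^^ n) c \<noteq> c"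
    using nonperiodic_element[OF complete_K1 comm_K1 canonical_aut_iso np] by blast
  obtain a where a: "a \<in> fil 0" "res a = c" using res_surj[OF c(1)] by blast
  have ac: "a \<in> carrier R" using a fil_carrier by blast
  define s where "s Y = (THE x. x \<in> fil 0 \<and> res x = Y \<and> x \<otimes> a = a \<otimes> x)" for Y
  have lift: "\<exists>!x. x \<in> fil 0 \<and> res x = Y \<and> x \<otimes> a = a \<otimes> x" if "Y \<in> carrier K1" for Y
    using unique_commuting_lift[OF a(1) _ that] c(2) a(2) by simp
  have s: "s Y \<in> fil 0" "res (s Y) = Y" "s Y \<otimes> a = a \<otimes> s Y" if "Y \<in> carrier K1" for Y
    using theI'[OF lift[OF that]] by (simp_all add: s_def)
  \<comment> \<open>Any integral element commuting with \<open>a\<close> is the chosen lift of its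
    residue. Sums and products of such elements commute with \<open>a\<close> again, which makes
    \<open>s\<close> a homomorphism.\<close>
  have s_eq: "s (res x) = x" if "x \<in> fil 0" "x \<otimes> a = a \<otimes> x" for x
    using lift[OF res_closed[OF that(1)]] s[OF res_closed[OF that(1)]] that by blast
  have sc: "s Y \<in> carrier R" if "Y \<in> carrier K1" for Y using s(1)[OF that] fil_carrier by blast
  have s_mult: "s (Z \<otimes>\<^bsub>K1\<^esub> Y) = s Z \<otimes> s Y" if "Z \<in> carrier K1" "Y \<in> carrier K1" for Z Y
  proof -
    have "s Z \<otimes> s Y \<otimes> a = a \<otimes> (s Z \<otimes> s Y)"
      using s(3)[OF that(1)] s(3)[OF that(2)] sc that ac by (metis m_assoc)
    then have "s (res (s Z \<otimes> s Y)) = s Z \<otimes> s Y" using s that by (intro s_eq) (auto intro: fil_mult_l)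
    then show ?thesis using s that by (simp add: res_mult)
  qed
  have s_add: "s (Z \<oplus>\<^bsub>K1\<^esub> Y) = s Z \<oplus> s Y" if "Z \<in> carrier K1" "Y \<in> carrier K1" for Z Y
  proof -
    have "(s Z \<oplus> s Y) \<otimes> a = a \<otimes> (s Z \<oplus> s Y)"
      using s(3)[OF that(1)] s(3)[OF that(2)] sc that ac by (simp add: l_distr r_distr)
    then have "s (res (s Z \<oplus> s Y)) = s Z \<oplus> s Y" using s that by (intro s_eq) (auto intro: fil_add)
    then show ?thesis using s that by (simp add: res_add)
  qed
  have s_one: "s \<one>\<^bsub>K1\<^esub> = \<one>" using s_eq[of \<one>] ac by (simp add: res_one)
  have hom: "s \<in> ring_hom K1 (R\<lparr>carrier := valuation_ring R v\<rparr>)"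
    by (rule ring_hom_memI) (auto simp: s s_mult s_add s_one valuation_ring_eq)
  define b where "b = s (\<alpha> c)"
  have ac1: "\<alpha> c \<in> carrier K1" using canonical_aut(1) c by blast
  have b: "b \<in> fil 0" "res b = \<alpha> c" "b \<in> carrier R" using s[OF ac1] sc[OF ac1] by (simp_all add: b_def)
  \<comment> \<open>Injectivity of \<alpha> removes one application from both sides.\<close>
  have pow: "(\<alpha> ^^ Suc n) c \<noteq> \<alpha> c" if "1 \<le> n" for n
    using c(2)[OF that] canonical_aut(5) c(1) canonical_aut_pow(1)[OF c(1), of n]
    unfolding bij_betw_def inj_on_def by auto
  \<comment> \<open>Hence \<open>b\<close> satisfies the hypothesis on \<open>a\<close> too, and
    lifts commuting with \<open>b\<close> are unique.\<close>
  have bpow: "(\<alpha> ^^ n) (res b) \<noteq> res b" if "1 \<le> n" for n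
    using pow[OF that] b(2) by (simp add: funpow_swap1)
  obtain t0 where "uniformized_dvsf R v t0" by (rule ex_uniformizer)
  then interpret t0: uniformized_dvsf R v t0 .
  \<comment> \<open>Both \<open>b\<close> and the conjugate of \<open>a\<close> by \<open>t0\<close>
    lift \<alpha>(c), so they agree up to \<open>fil 1\<close>; the factor \<open>t0\<close>
    contributes one more degree.\<close>
  have "t0 \<otimes> a \<ominus> b \<otimes> t0 \<in> fil (int 2)"
  proof -
    define a' where "a' = t0 \<otimes> a \<otimes> inv t0"
    have a': "a' \<in> fil 0" "res a' = \<alpha> c" "a' \<in> carrier R" "t0 \<otimes> a = a' \<otimes> t0"
      using conj_fil[OF t0.t_carrier t0.t_nonzero a(1)] canonical_aut_res[OF t0.t_carrier t0.t_nonzero t0.val_t a(1)] a ac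
      by (simp_all add: a'_def m_assoc)
    then have "a' \<ominus> b \<in> fil 1" using b res_eq_iff[of a' b] by metis
    moreover have "t0 \<otimes> a \<ominus> b \<otimes> t0 = (a' \<ominus> b) \<otimes> t0" unfolding a'(4) using a'(3) b(3) t0.t_carrier by algebra
    moreover have "t0 \<in> fil 1" by (simp add: fil_iff)
    ultimately show ?thesis using fil_mult[of "a' \<ominus> b" 1 t0 1] by simp
  qed
  then have "\<exists>x \<in> fil (int 2). x \<otimes> a \<ominus> b \<otimes> x = t0 \<otimes> a \<ominus> b \<otimes> t0"
  proof (rule sylvester_surj[OF a(1) b(1), rotated])
    fix n :: nat assume "2 \<le> n"
    then have "n = Suc (n - 1)" "1 \<le> n - 1" by auto
    then show "(\<alpha> ^^ n) (res a) \<noteq> res b" using pow[of "n - 1"] a b by metis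
  qed
  then obtain x where x: "x \<in> fil 2" "x \<otimes> a \<ominus> b \<otimes> x = t0 \<otimes> a \<ominus> b \<otimes> t0" by auto
  have xc: "x \<in> carrier R" using x fil_carrier by blast
  define t where "t = t0 \<ominus> x"
  have tc: "t \<in> carrier R" using xc by (simp add: t_def)
  \<comment> \<open>The correction \<open>x\<close> lies in \<open>fil 2\<close>, so
    \<open>t\<close> keeps the leading term of \<open>t0\<close> and is again a prime
    element.\<close>
  have "t0 \<notin> fil 2" "t0 \<in> fil 1" by (simp_all add: fil_iff)
  then have t12: "t \<in> fil 1" "t \<notin> fil 2"
    using fil_minus_cancel[of t0 x 2] x(1) fil_minus[of t0 1 x] fil_mono[of x 2 1] by (auto simp: t_def)
  then have t: "t \<noteq> \<zero>" "v t = 1" using tc by (auto simp: fil_iff)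
  have "t \<otimes> a \<ominus> b \<otimes> t = (t0 \<otimes> a \<ominus> b \<otimes> t0) \<ominus> (x \<otimes> a \<ominus> b \<otimes> x)"
    unfolding t_def using xc ac b(3) t0.t_carrier by algebra
  also have "\<dots> = \<zero>" using x ac b(3) by (simp add: minus_eq r_neg)
  finally have ta: "t \<otimes> a = b \<otimes> t" using tc ac b(3) by (simp add: r_right_minus_eq)
  have ut: "uniformized_dvsf R v t" using tc t by unfold_locales
  have "t \<otimes> s Y = s (\<alpha> Y) \<otimes> t" if Y: "Y \<in> carrier K1" for Y
  proof -
    define u where "u = t \<otimes> s Y \<otimes> inv t"
    have aY: "\<alpha> Y \<in> carrier K1" using canonical_aut(1) Y by blast
    have u: "u \<in> fil 0" "res u = \<alpha> Y" "u \<otimes> t = t \<otimes> s Y" "u \<in> carrier R"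
      using conj_fil[OF tc t(1) s(1)[OF Y]] canonical_aut_res[OF tc t s(1)[OF Y]] s[OF Y] sc[OF Y] tc t
      by (simp_all add: u_def m_assoc)
    have "(u \<otimes> b) \<otimes> t = u \<otimes> t \<otimes> a" using u(4) b(3) ac tc by (simp add: m_assoc ta)
    also have "\<dots> = t \<otimes> (a \<otimes> s Y)" using u tc sc[OF Y] ac s(3)[OF Y] by (simp add: m_assoc)
    also have "\<dots> = (t \<otimes> a) \<otimes> s Y" using tc sc[OF Y] ac by (simp add: m_assoc)
    also have "\<dots> = (b \<otimes> u) \<otimes> t" using b tc sc[OF Y] u by (simp add: m_assoc ta)
    finally have ub: "u \<otimes> b = b \<otimes> u" using mult_right_cancel tc t u b by simp
    \<comment> \<open>\<open>b\<close> is itself a value of \<open>s\<close>, and the image of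
      \<open>s\<close> is commutative.\<close>
    have "s (\<alpha> Y) \<otimes> b = b \<otimes> s (\<alpha> Y)"
      unfolding b_def using K1.m_comm[OF aY ac1] s_mult aY ac1 by metis
    then have "u = s (\<alpha> Y)"
      using unique_commuting_lift[OF b(1) bpow aY] u ub s[OF aY] by blast
    then show ?thesis using u by simp
  qed
  with that[OF hom s(2) ut] show ?thesis by blast
qed

end

section \<open>Skew Laurent expansions\<close>

text \<open>The coefficients live in an abstract \<open>F\<close> that \<open>s\<close> embeds as
  representatives of the residues, rather than in K_1 itself. Two skew fields with conjugate
  canonical automorphisms can then be expanded over the same \<open>F\<close>.\<close>

locale skew_expansion = complete_dvsf_loc R v + uniformized_dvsf R v t + F: ring F
  for R :: "('a, 'm) ring_scheme" (structure) and v t and F :: "('b, 'n) ring_scheme" +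
  fixes s :: "'b \<Rightarrow> 'a" and \<beta> :: "'b \<Rightarrow> 'b"
  assumes s_hom: "s \<in> ring_hom F (R\<lparr>carrier := valuation_ring R v\<rparr>)"
    and res_s_bij: "bij_betw (\<lambda>a. res (s a)) (carrier F) (carrier K1)"
    and \<beta>_bij: "bij_betw \<beta> (carrier F) (carrier F)"
    and t_commute: "a \<in> carrier F \<Longrightarrow> t \<otimes> s a = s (\<beta> a) \<otimes> t"
begin

lemma s_fil [simp]: "a \<in> carrier F \<Longrightarrow> s a \<in> fil 0"
  and s_add: "\<lbrakk>a \<in> carrier F; b \<in> carrier F\<rbrakk> \<Longrightarrow> s (a \<oplus>\<^bsub>F\<^esub> b) = s a \<oplus> s b"
  and s_mult: "\<lbrakk>a \<in> carrier F; b \<in> carrier F\<rbrakk> \<Longrightarrow> s (a \<otimes>\<^bsub>F\<^esub> b) = s a \<otimes> s b"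
  and s_one: "s \<one>\<^bsub>F\<^esub> = \<one>"
  using s_hom by (auto simp: ring_hom_def valuation_ring_eq)

lemma s_closed [simp]: "a \<in> carrier F \<Longrightarrow> s a \<in> carrier R"
  using fil_carrier s_fil by blast

lemma s_zero [simp]: "s \<zero>\<^bsub>F\<^esub> = \<zero>"
  using s_add[of "\<zero>\<^bsub>F\<^esub>" "\<zero>\<^bsub>F\<^esub>"] by (metis F.zero_closed F.l_zero add.l_cancel_one' s_closed)

lemma s_minus: "\<lbrakk>a \<in> carrier F; b \<in> carrier F\<rbrakk> \<Longrightarrow> s (a \<ominus>\<^bsub>F\<^esub> b) = s a \<ominus> s b"
proof -
  assume ab: "a \<in> carrier F" "b \<in> carrier F"
  then have "(a \<ominus>\<^bsub>F\<^esub> b) \<oplus>\<^bsub>F\<^esub> b = a" by algebra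
  then have *: "s (a \<ominus>\<^bsub>F\<^esub> b) \<oplus> s b = s a" using ab s_add F.minus_closed by metis
  have "s (a \<ominus>\<^bsub>F\<^esub> b) = (s (a \<ominus>\<^bsub>F\<^esub> b) \<oplus> s b) \<ominus> s b"
    using s_closed[OF F.minus_closed[OF ab]] s_closed[OF ab(2)] by algebra
  then show ?thesis using * by simp
qed

lemma s_fil_1_iff: "a \<in> carrier F \<Longrightarrow> s a \<in> fil 1 \<longleftrightarrow> a = \<zero>\<^bsub>F\<^esub>"
proof
  assume a: "a \<in> carrier F" "s a \<in> fil 1"
  then have "res (s a) = res (s \<zero>\<^bsub>F\<^esub>)" by (simp add: res_eq_zero_iff res_zero)
  with a show "a = \<zero>\<^bsub>F\<^esub>" using res_s_bij unfolding bij_betw_def inj_on_def by blast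
qed simp

lemma s_inj: "\<lbrakk>a \<in> carrier F; b \<in> carrier F; s a = s b\<rbrakk> \<Longrightarrow> a = b"
  using res_s_bij unfolding bij_betw_def inj_on_def by auto

abbreviation \<beta>pow :: "int \<Rightarrow> 'b \<Rightarrow> 'b" where "\<beta>pow \<equiv> aut_ipow F \<beta>"

lemma \<beta>pow:
  assumes "a \<in> carrier F" shows "\<beta>pow i a \<in> carrier F \<and> T i \<otimes> s a = s (\<beta>pow i a) \<otimes> T i"
proof -
  let ?\<gamma> = "inv_into (carrier F) \<beta>"
  have \<beta>: "\<beta> b \<in> carrier F" "?\<gamma> b \<in> carrier F" "\<beta> (?\<gamma> b) = b" if "b \<in> carrier F" for b
    using \<beta>_bij that by (auto simp: bij_betw_def f_inv_into_f inv_into_into)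
  have pos: "(\<beta> ^^ n) a \<in> carrier F \<and> T (int n) \<otimes> s a = s ((\<beta> ^^ n) a) \<otimes> T (int n)" for n
  proof (induction n)
    case (Suc n)
    have T: "T (int (Suc n)) = t \<otimes> T (int n)" using T_add[of 1 "int n"] by simp
    have c: "(\<beta> ^^ n) a \<in> carrier F" using Suc by blast
    have "T (int (Suc n)) \<otimes> s a = t \<otimes> (s ((\<beta> ^^ n) a) \<otimes> T (int n))"
      unfolding T using Suc assms by (simp add: m_assoc)
    also have "\<dots> = s ((\<beta> ^^ Suc n) a) \<otimes> T (int (Suc n))"
      unfolding T using c t_commute[OF c] \<beta>(1)[OF c] by (simp flip: m_assoc)
    finally show ?case using \<beta>(1)[OF c] by simp
  qed (use assms in simp)
  \<comment> \<open>The rule for \<open>t\<close>, applied to the preimage of \<open>b\<close> under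
    \<beta> and multiplied by the inverse of \<open>t\<close> on both sides.\<close>
  have neg1: "T (-1) \<otimes> s b = s (?\<gamma> b) \<otimes> T (-1)" if "b \<in> carrier F" for b
  proof -
    have T: "T (-1) \<otimes> t = \<one>" "t \<otimes> T (-1) = \<one>" using T_cancel[of 1] by simp_all
    have "T (-1) \<otimes> s b = T (-1) \<otimes> (s (\<beta> (?\<gamma> b)) \<otimes> t) \<otimes> T (-1)"
      using that \<beta> T by (simp add: m_assoc)
    also have "\<dots> = T (-1) \<otimes> (t \<otimes> s (?\<gamma> b)) \<otimes> T (-1)"
      using t_commute[OF \<beta>(2)[OF that]] by simp
    also have "\<dots> = s (?\<gamma> b) \<otimes> T (-1)" using \<beta>(2)[OF that] T by (simp flip: m_assoc)
    finally show ?thesis .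
  qed
  have neg: "(?\<gamma> ^^ n) a \<in> carrier F \<and> T (- int n) \<otimes> s a = s ((?\<gamma> ^^ n) a) \<otimes> T (- int n)" for n
  proof (induction n)
    case (Suc n)
    have T: "T (- int (Suc n)) = T (-1) \<otimes> T (- int n)" using T_add[of "-1" "- int n"] by simp
    have c: "(?\<gamma> ^^ n) a \<in> carrier F" using Suc by blast
    have "T (- int (Suc n)) \<otimes> s a = T (-1) \<otimes> (s ((?\<gamma> ^^ n) a) \<otimes> T (- int n))"
      unfolding T using Suc assms by (simp add: m_assoc)
    also have "\<dots> = s ((?\<gamma> ^^ Suc n) a) \<otimes> T (- int (Suc n))"
      unfolding T using c neg1[OF c] \<beta>(2)[OF c] by (simp flip: m_assoc)
    finally show ?case using \<beta>(2)[OF c] by simp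
  qed (use assms in simp)
  show ?thesis using pos[of "nat i"] neg[of "nat (- i)"] by (cases "0 \<le> i") (simp_all add: aut_ipow_def)
qed

lemmas \<beta>pow_closed [simp] = \<beta>pow[THEN conjunct1] and T_s = \<beta>pow[THEN conjunct2]

text \<open>\<beta> is given only as a bijection; that its powers fix zero follows from the
  commutation rule and injectivity of \<open>s\<close>.\<close>

lemma \<beta>pow_zero [simp]: "\<beta>pow i \<zero>\<^bsub>F\<^esub> = \<zero>\<^bsub>F\<^esub>"
proof -
  have "s (\<beta>pow i \<zero>\<^bsub>F\<^esub>) \<otimes> T i = \<zero>" using T_s[of "\<zero>\<^bsub>F\<^esub>" i] by simp
  then have "s (\<beta>pow i \<zero>\<^bsub>F\<^esub>) = s \<zero>\<^bsub>F\<^esub>" by simp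
  then show ?thesis using s_inj by simp
qed

text \<open>The series $\sum_n s(f_n) t^n$ converges to \<open>x\<close>. Recording the remainders \<open>r\<close> instead of
  the partial sums makes sums and left multiples by monomials immediate.\<close>
definition expands :: "'a \<Rightarrow> (int \<Rightarrow> 'b) \<Rightarrow> bool" where
  "expands x f \<longleftrightarrow> x \<in> carrier R \<and> f \<in> laurent_carrier F \<and>
     (\<exists>r m. (\<forall>n\<le>m. r n = x) \<and> (\<forall>n. r n \<in> fil n \<and> r n = s (f n) \<otimes> T n \<oplus> r (n + 1)))"

lemma expandsI:
  assumes "x \<in> carrier R" "f \<in> laurent_carrier F" "\<And>n. n \<le> m \<Longrightarrow> r n = x" "\<And>n. r n \<in> fil n"
    "\<And>n. r n = s (f n) \<otimes> T n \<oplus> r (n + 1)"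
  shows "expands x f"
  using assms unfolding expands_def by (intro conjI exI[of _ r] exI[of _ m]) blast+

lemma laurent_carrierD: "f \<in> laurent_carrier F \<Longrightarrow> f n \<in> carrier F"
  and laurent_carrier_bound: "f \<in> laurent_carrier F \<Longrightarrow> \<exists>m. \<forall>n<m. f n = \<zero>\<^bsub>F\<^esub>"
  by (auto simp: laurent_carrier_def)

lemma laurent_carrierI: "\<lbrakk>\<And>n. f n \<in> carrier F; \<And>n. n < m \<Longrightarrow> f n = \<zero>\<^bsub>F\<^esub>\<rbrakk> \<Longrightarrow> f \<in> laurent_carrier F"
  by (auto simp: laurent_carrier_def)

text \<open>The definition pins the remainders down only below some index. As long as the
  coefficients vanish the recurrence leaves the remainder unchanged, so it is still \<open>x\<close>
  at every index with only zero coefficients before it.\<close>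

lemma expandsE:
  assumes "expands x f"
  obtains r where "x \<in> carrier R" "f \<in> laurent_carrier F" "\<And>n. f n \<in> carrier F"
    "\<And>n. r n \<in> fil n" "\<And>n. r n \<in> carrier R" "\<And>n. r n = s (f n) \<otimes> T n \<oplus> r (n + 1)"
    "\<And>n. (\<forall>j<n. f j = \<zero>\<^bsub>F\<^esub>) \<Longrightarrow> r n = x"
proof -
  obtain r m where r: "\<And>n. n \<le> m \<Longrightarrow> r n = x" "\<And>n. r n \<in> fil n" "\<And>n. r n = s (f n) \<otimes> T n \<oplus> r (n + 1)"
    and xf: "x \<in> carrier R" "f \<in> laurent_carrier F"
    using assms unfolding expands_def by blast
  have rc: "r n \<in> carrier R" for n using r(2) fil_carrier by blast
  have "r n = x" if "\<forall>j<n. f j = \<zero>\<^bsub>F\<^esub>" for n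
  proof -
    have "m + int k \<le> n \<Longrightarrow> r (m + int k) = x" for k
    proof (induction k)
      case (Suc k)
      have "r (m + int k) = s (f (m + int k)) \<otimes> T (m + int k) \<oplus> r (m + int k + 1)" by (rule r(3))
      also have "s (f (m + int k)) = \<zero>" using that Suc.prems by simp
      finally show ?case using Suc rc by (simp add: ac_simps)
    qed (use r(1) in simp)
    from this[of "nat (n - m)"] show ?thesis using r(1) by (cases "n \<le> m") auto
  qed
  with that[OF xf laurent_carrierD[OF xf(2)] r(2) rc r(3)] show ?thesis by blast
qed

lemma leading_coefficient:
  assumes "z \<in> fil n" shows "\<exists>a \<in> carrier F. z \<ominus> s a \<otimes> T n \<in> fil (n + 1)"
proof -
  obtain w where w: "w \<in> fil 0" "z = w \<otimes> T n" using fil_divide[OF assms] by blast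
  have "res w \<in> (\<lambda>a. res (s a)) ` carrier F" using res_s_bij w by (simp add: bij_betw_def)
  then obtain a where a: "a \<in> carrier F" "res (s a) = res w" by force
  then have "w \<ominus> s a \<in> fil 1" using w(1) res_eq_iff[of w "s a"] by simp
  moreover have "z \<ominus> s a \<otimes> T n = (w \<ominus> s a) \<otimes> T n"
    unfolding w(2) using w(1)[THEN fil_carrier] s_closed[OF a(1)] T_carrier[of n] by algebra
  ultimately show ?thesis using fil_mult[OF _ T_fil, of _ 1 n n] a(1)
    by (metis add.commute order_refl)
qed

text \<open>Greedy choice of leading coefficients; the successive errors are the remainders that
  \<open>expands\<close> asks for.\<close>

lemma ex_expansion:
  assumes x: "x \<in> carrier R" shows "\<exists>f. expands x f"
proof -
  obtain m where m: "x \<in> fil m" using in_some_fil x by blast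
  define c where "c n z = (SOME a. a \<in> carrier F \<and> z \<ominus> s a \<otimes> T n \<in> fil (n + 1))" for n z
  have c: "c n z \<in> carrier F \<and> z \<ominus> s (c n z) \<otimes> T n \<in> fil (n + 1)" if "z \<in> fil n" for n z
    unfolding c_def using leading_coefficient[OF that] by (rule someI2_bex) blast
  define \<rho> where "\<rho> = rec_nat x (\<lambda>k z. z \<ominus> s (c (m + int k) z) \<otimes> T (m + int k))"
  have \<rho>0: "\<rho> 0 = x" and \<rho>S: "\<rho> (Suc k) = \<rho> k \<ominus> s (c (m + int k) (\<rho> k)) \<otimes> T (m + int k)" for k
    by (simp_all add: \<rho>_def)
  have \<rho>: "\<rho> k \<in> fil (m + int k)" for k
  proof (induction k)
    case (Suc k)
    show ?case using c[OF Suc] by (simp add: \<rho>S algebra_simps)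
  qed (use m in \<open>simp add: \<rho>0\<close>)
  have \<rho>c: "\<rho> k \<in> carrier R" for k using \<rho> fil_carrier by blast
  define r where "r n = (if n \<le> m then x else \<rho> (nat (n - m)))" for n
  \<comment> \<open>Below \<open>m\<close> the remainder stays equal to \<open>x\<close>, so the
    coefficients there have to be zero.\<close>
  define f where "f n = (if n < m then \<zero>\<^bsub>F\<^esub> else c n (r n))" for n
  have r: "r n \<in> fil n" for n
    using \<rho>[of "nat (n - m)"] m fil_mono[OF m] by (auto simp: r_def)
  have f: "f n \<in> carrier F" for n using c r by (simp add: f_def)
  have "expands x f"
  proof (rule expandsI[where r = r and m = m])
    show "f \<in> laurent_carrier F" using f by (intro laurent_carrierI[of _ m]) (simp_all add: f_def)
    show "r n = s (f n) \<otimes> T n \<oplus> r (n + 1)" for n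
    proof (cases "n < m")
      case False
      define k where "k = nat (n - m)"
      have k: "n = m + int k" using False by (simp add: k_def)
      have rk: "r n = \<rho> k" "r (n + 1) = \<rho> (Suc k)" using \<rho>0
        by (auto simp: r_def k nat_add_distrib)
      have "r (n + 1) = r n \<ominus> s (f n) \<otimes> T n" unfolding rk \<rho>S using False rk by (simp add: f_def k)
      moreover have "r n \<in> carrier R" using rk \<rho>c by simp
      ultimately show ?thesis using s_closed[OF f[of n]] T_carrier[of n] by algebra
    qed (use x in \<open>simp add: r_def f_def\<close>)
  qed (use x r in \<open>auto simp: r_def\<close>)
  then show ?thesis by blast
qed

lemma ex_value:
  assumes f: "f \<in> laurent_carrier F" shows "\<exists>x. expands x f"
proof -
  note fc = laurent_carrierD[OF f]
  obtain m where m: "\<And>n. n < m \<Longrightarrow> f n = \<zero>\<^bsub>F\<^esub>" using laurent_carrier_bound[OF f] by blast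
  define P where "P = rec_nat \<zero> (\<lambda>k z. z \<oplus> s (f (m + int k)) \<otimes> T (m + int k))"
  have P0: "P 0 = \<zero>" and PS: "P (Suc k) = P k \<oplus> s (f (m + int k)) \<otimes> T (m + int k)" for k
    by (simp_all add: P_def)
  have Pc: "P k \<in> carrier R" for k by (induction k) (simp_all add: P0 PS fc)
  have Pd: "P (Suc k) \<ominus> P k \<in> fil (m + int k)" for k
  proof -
    have "P (Suc k) \<ominus> P k = s (f (m + int k)) \<otimes> T (m + int k)"
      unfolding PS using Pc[of k] s_closed[OF fc[of "m + int k"]] T_carrier[of "m + int k"] by algebra
    then show ?thesis using fil_mult_l[OF s_fil[OF fc] T_fil] by simp
  qed
  obtain x where x: "x \<in> carrier R" "\<And>k. x \<ominus> P k \<in> fil (m + int k)" using fil_limit[OF Pc Pd] by blast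
  define r where "r n = (if n \<le> m then x else x \<ominus> P (nat (n - m)))" for n
  have "expands x f"
  proof (rule expandsI[where r = r and m = m])
    have xm: "x \<in> fil m" using x(2)[of 0] x(1) by (simp add: P0 minus_eq)
    show "r n \<in> fil n" for n
      using x(2)[of "nat (n - m)"] fil_mono[OF xm] by (auto simp: r_def)
    show "r n = s (f n) \<otimes> T n \<oplus> r (n + 1)" for n
    proof (cases "n < m")
      case False
      define k where "k = nat (n - m)"
      have k: "n = m + int k" using False by (simp add: k_def)
      have rk: "r n = x \<ominus> P k" "r (n + 1) = x \<ominus> P (Suc k)" using P0 x(1)
        by (auto simp: r_def k nat_add_distrib minus_eq)
      have Pn: "P (Suc k) = P k \<oplus> s (f n) \<otimes> T n" using PS k by simp
      show ?thesis unfolding rk Pn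
        using Pc[of k] s_closed[OF fc[of n]] T_carrier[of n] x(1) by algebra
    qed (use x m in \<open>simp add: r_def\<close>)
  qed (use x f in \<open>auto simp: r_def\<close>)
  then show ?thesis by blast
qed

section \<open>Expansions of sums and monomial multiples\<close>

lemma expands_add:
  assumes "expands x f" "expands y g" shows "expands (x \<oplus> y) (\<lambda>n. f n \<oplus>\<^bsub>F\<^esub> g n)"
proof -
  from assms(1) obtain r where r: "x \<in> carrier R" "f \<in> laurent_carrier F" "\<And>n. f n \<in> carrier F"
    "\<And>n. r n \<in> fil n" "\<And>n. r n \<in> carrier R" "\<And>n. r n = s (f n) \<otimes> T n \<oplus> r (n + 1)"
    "\<And>n. (\<forall>j<n. f j = \<zero>\<^bsub>F\<^esub>) \<Longrightarrow> r n = x" by (rule expandsE) blast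
  from assms(2) obtain q where q: "y \<in> carrier R" "g \<in> laurent_carrier F" "\<And>n. g n \<in> carrier F"
    "\<And>n. q n \<in> fil n" "\<And>n. q n \<in> carrier R" "\<And>n. q n = s (g n) \<otimes> T n \<oplus> q (n + 1)"
    "\<And>n. (\<forall>j<n. g j = \<zero>\<^bsub>F\<^esub>) \<Longrightarrow> q n = y" by (rule expandsE) blast
  obtain m1 where m1: "\<forall>n<m1. f n = \<zero>\<^bsub>F\<^esub>" using laurent_carrier_bound r(2) by blast
  obtain m2 where m2: "\<forall>n<m2. g n = \<zero>\<^bsub>F\<^esub>" using laurent_carrier_bound q(2) by blast
  show ?thesis
  proof (rule expandsI[where r = "\<lambda>n. r n \<oplus> q n" and m = "min m1 m2"])
    show "(\<lambda>n. f n \<oplus>\<^bsub>F\<^esub> g n) \<in> laurent_carrier F"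
      using r(3) q(3) m1 m2 by (intro laurent_carrierI[of _ "min m1 m2"]) auto
    show "r n \<oplus> q n = x \<oplus> y" if "n \<le> min m1 m2" for n
      using r(7)[of n] q(7)[of n] m1 m2 that by auto
    show "r n \<oplus> q n = s (f n \<oplus>\<^bsub>F\<^esub> g n) \<otimes> T n \<oplus> (r (n + 1) \<oplus> q (n + 1))" for n
      unfolding s_add[OF r(3) q(3)] r(6)[of n] q(6)[of n]
      using r(5)[of "n + 1"] q(5)[of "n + 1"] s_closed[OF r(3)[of n]] s_closed[OF q(3)[of n]] T_carrier[of n]
      by algebra
  qed (use r(1,4) q(1,4) in \<open>auto intro: fil_add\<close>)
qed

lemma expands_monomial_mult:
  assumes a: "a \<in> carrier F" and "expands y g"
  shows "expands (s a \<otimes> T i \<otimes> y) (\<lambda>n. a \<otimes>\<^bsub>F\<^esub> \<beta>pow i (g (n - i)))"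
proof -
  from assms(2) obtain q where q: "y \<in> carrier R" "g \<in> laurent_carrier F" "\<And>n. g n \<in> carrier F"
    "\<And>n. q n \<in> fil n" "\<And>n. q n \<in> carrier R" "\<And>n. q n = s (g n) \<otimes> T n \<oplus> q (n + 1)"
    "\<And>n. (\<forall>j<n. g j = \<zero>\<^bsub>F\<^esub>) \<Longrightarrow> q n = y" by (rule expandsE) blast
  obtain m where m: "\<forall>n<m. g n = \<zero>\<^bsub>F\<^esub>" using laurent_carrier_bound q(2) by blast
  show ?thesis
  proof (rule expandsI[where r = "\<lambda>n. s a \<otimes> T i \<otimes> q (n - i)" and m = "m + i"])
    show "(\<lambda>n. a \<otimes>\<^bsub>F\<^esub> \<beta>pow i (g (n - i))) \<in> laurent_carrier F"
      using q(3) m a by (intro laurent_carrierI[of _ "m + i"]) auto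
    show "s a \<otimes> T i \<otimes> q (n - i) = s a \<otimes> T i \<otimes> y" if "n \<le> m + i" for n
      using q(7)[of "n - i"] m that by auto
    show "s a \<otimes> T i \<otimes> q (n - i) \<in> fil n" for n
      using fil_mult[OF fil_mult_l[OF s_fil[OF a] T_fil[of i i]] q(4)[of "n - i"]] by simp
    show "s a \<otimes> T i \<otimes> q (n - i) =
        s (a \<otimes>\<^bsub>F\<^esub> \<beta>pow i (g (n - i))) \<otimes> T n \<oplus> s a \<otimes> T i \<otimes> q (n + 1 - i)" for n
    proof -
      define b where "b = g (n - i)"
      have b: "b \<in> carrier F" "\<beta>pow i b \<in> carrier F" using q(3) by (simp_all add: b_def)
      have e: "n - i + 1 = n + 1 - i" by simp
      have "s a \<otimes> T i \<otimes> q (n - i) = s a \<otimes> (T i \<otimes> s b) \<otimes> T (n - i) \<oplus> s a \<otimes> T i \<otimes> q (n + 1 - i)"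
        unfolding q(6)[of "n - i"] e using a b q(5) by (simp add: r_distr m_assoc flip: b_def)
      also have "s a \<otimes> (T i \<otimes> s b) \<otimes> T (n - i) = s (a \<otimes>\<^bsub>F\<^esub> \<beta>pow i b) \<otimes> (T i \<otimes> T (n - i))"
        using a b by (simp add: T_s s_mult m_assoc)
      finally show ?thesis by (simp add: b_def flip: T_add)
    qed
  qed (use q(1) a in auto)
qed

lemma expands_zero: "expands \<zero> (\<lambda>_. \<zero>\<^bsub>F\<^esub>)"
  by (rule expandsI[where r = "\<lambda>_. \<zero>"]) (auto intro: laurent_carrierI)

lemma expands_uminus:
  assumes "expands x f" shows "expands (\<ominus> x) (\<lambda>n. \<ominus>\<^bsub>F\<^esub> f n)"
proof -
  from assms(1) obtain r where r: "x \<in> carrier R" "f \<in> laurent_carrier F" "\<And>n. f n \<in> carrier F"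
    "\<And>n. r n \<in> fil n" "\<And>n. r n \<in> carrier R" "\<And>n. r n = s (f n) \<otimes> T n \<oplus> r (n + 1)"
    "\<And>n. (\<forall>j<n. f j = \<zero>\<^bsub>F\<^esub>) \<Longrightarrow> r n = x" by (rule expandsE) blast
  obtain m where m: "\<forall>n<m. f n = \<zero>\<^bsub>F\<^esub>" using laurent_carrier_bound r(2) by blast
  have sm: "s (\<ominus>\<^bsub>F\<^esub> f n) = \<ominus> s (f n)" for n
    using s_minus[of "\<zero>\<^bsub>F\<^esub>" "f n"] r(3) by (simp add: F.minus_eq minus_eq)
  show ?thesis
  proof (rule expandsI[where r = "\<lambda>n. \<ominus> r n" and m = m])
    show "(\<lambda>n. \<ominus>\<^bsub>F\<^esub> f n) \<in> laurent_carrier F"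
      using r(3) m by (intro laurent_carrierI[of _ m]) auto
    show "\<ominus> r n = \<ominus> x" if "n \<le> m" for n using r(7)[of n] m that by auto
    show "\<ominus> r n = s (\<ominus>\<^bsub>F\<^esub> f n) \<otimes> T n \<oplus> \<ominus> r (n + 1)" for n
      unfolding sm r(6)[of n] using r(5)[of "n + 1"] s_closed[OF r(3)[of n]] T_carrier[of n] by algebra
  qed (use r(1,4) in \<open>auto intro: fil_uminus\<close>)
qed

lemma expands_minus:
  "\<lbrakk>expands x f; expands y g\<rbrakk> \<Longrightarrow> expands (x \<ominus> y) (\<lambda>n. f n \<ominus>\<^bsub>F\<^esub> g n)"
  using expands_add[OF _ expands_uminus] by (simp add: a_minus_def)

text \<open>If all coefficients before j vanish, then s(f_j) t^j = x - r(j+1). For x in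
  \<open>fil (j + 1)\<close> this forces s(f_j) into the maximal ideal, where \<open>s\<close> takes
  only zero.\<close>

lemma expands_fil_iff:
  assumes "expands x f" shows "x \<in> fil n \<longleftrightarrow> (\<forall>j<n. f j = \<zero>\<^bsub>F\<^esub>)"
proof -
  from assms(1) obtain r where r: "x \<in> carrier R" "f \<in> laurent_carrier F" "\<And>n. f n \<in> carrier F"
    "\<And>n. r n \<in> fil n" "\<And>n. r n \<in> carrier R" "\<And>n. r n = s (f n) \<otimes> T n \<oplus> r (n + 1)"
    "\<And>n. (\<forall>j<n. f j = \<zero>\<^bsub>F\<^esub>) \<Longrightarrow> r n = x" by (rule expandsE) blast
  obtain m where m: "\<forall>n<m. f n = \<zero>\<^bsub>F\<^esub>" using laurent_carrier_bound r(2) by blast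
  show ?thesis
  proof
    assume "\<forall>j<n. f j = \<zero>\<^bsub>F\<^esub>" then show "x \<in> fil n" using r(4,7) by metis
  next
    assume x: "x \<in> fil n"
    have "m + int k \<le> n \<Longrightarrow> \<forall>j<m + int k. f j = \<zero>\<^bsub>F\<^esub>" for k
    proof (induction k)
      case (Suc k)
      let ?j = "m + int k"
      have z: "\<forall>j<?j. f j = \<zero>\<^bsub>F\<^esub>" using Suc by simp
      then have "x = s (f ?j) \<otimes> T ?j \<oplus> r (?j + 1)" using r(6,7)[of ?j] by simp
      then have e: "s (f ?j) \<otimes> T ?j = x \<ominus> r (?j + 1)"
        using r(5)[of "?j + 1"] s_closed[OF r(3)[of ?j]] T_carrier[of ?j] by algebra
      have "s (f ?j) \<otimes> T ?j \<in> fil (1 + ?j)"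
        unfolding e using r(4)[of "?j + 1"] fil_mono[OF x, of "?j + 1"] Suc.prems
        by (intro fil_minus) (auto simp: ac_simps)
      then have "f ?j = \<zero>\<^bsub>F\<^esub>" using r(3) by (simp only: fil_T_iff s_closed s_fil_1_iff)
      then show ?case using z by (metis add.assoc add.commute of_nat_Suc zle_add1_eq_le order_le_less)
    qed (use m in simp)
    from this[of "nat (n - m)"] show "\<forall>j<n. f j = \<zero>\<^bsub>F\<^esub>" using m by (cases "n \<le> m") auto
  qed
qed

lemma expands_unique_series:
  assumes "expands x f" "expands x g" shows "f = g"
proof
  fix n
  have x: "x \<in> carrier R" and c: "f n \<in> carrier F" "g n \<in> carrier F"
    using assms laurent_carrierD by (auto simp: expands_def)
  have "expands \<zero> (\<lambda>n. f n \<ominus>\<^bsub>F\<^esub> g n)"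
    using expands_minus[OF assms] x by (simp add: minus_eq r_neg)
  from expands_fil_iff[OF this, of "n + 1"] have "f n \<ominus>\<^bsub>F\<^esub> g n = \<zero>\<^bsub>F\<^esub>" by simp
  then show "f n = g n" using c by (simp add: F.r_right_minus_eq)
qed

text \<open>A continuity criterion, used for products, where only truncations are accessible to
  finite algebra. The value of \<open>h\<close> exists by \<open>ex_value\<close>, and the
  approximations force \<open>x\<close> to equal it.\<close>

lemma expands_approx:
  assumes h: "h \<in> laurent_carrier F" and x: "x \<in> carrier R"
    and approx: "\<And>n. \<exists>x' h'. expands x' h' \<and> x \<ominus> x' \<in> fil n \<and> (\<forall>j<n. h' j = h j)"
  shows "expands x h"
proof -
  obtain y where y: "expands y h" using ex_value[OF h] by blast
  have yc: "y \<in> carrier R" using y by (simp add: expands_def)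
  have "x \<ominus> y \<in> fil n" for n
  proof -
    obtain x' h' where x': "expands x' h'" "x \<ominus> x' \<in> fil n" "\<forall>j<n. h' j = h j" using approx by blast
    have "x' \<ominus> y \<in> fil n"
      using expands_fil_iff[OF expands_minus[OF x'(1) y], of n] x'(3) laurent_carrierD[OF h]
      by (simp add: F.minus_eq F.r_neg)
    moreover have "x' \<in> carrier R" using x' by (simp add: expands_def)
    ultimately show ?thesis using fil_minus_trans[OF x'(2) _ x _ yc] by blast
  qed
  then have "x = y" using x yc by (intro eq_if_fil) auto
  then show ?thesis using y by simp
qed

lemma expands_unique_value:
  assumes "expands x f" "expands y f" shows "x = y"
proof -
  have c: "f \<in> laurent_carrier F" "x \<in> carrier R" "y \<in> carrier R" using assms by (auto simp: expands_def)
  have "x \<ominus> y \<in> fil n" for n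
    using expands_fil_iff[OF expands_minus[OF assms], of n] laurent_carrierD[OF c(1)]
    by (simp add: F.minus_eq F.r_neg)
  then show ?thesis using c by (intro eq_if_fil) auto
qed

lemma expands_one: "expands \<one> (\<lambda>n. if n = 0 then \<one>\<^bsub>F\<^esub> else \<zero>\<^bsub>F\<^esub>)"
proof (rule expandsI[where r = "\<lambda>n. if n \<le> 0 then \<one> else \<zero>" and m = 0])
  show "(\<lambda>n. if n = 0 then \<one>\<^bsub>F\<^esub> else \<zero>\<^bsub>F\<^esub>) \<in> laurent_carrier F"
    by (intro laurent_carrierI[of _ 0]) auto
  show "(if n \<le> 0 then \<one> else \<zero>) =
    s (if n = 0 then \<one>\<^bsub>F\<^esub> else \<zero>\<^bsub>F\<^esub>) \<otimes> T n \<oplus> (if n + 1 \<le> 0 then \<one> else \<zero>)" for n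
    by (cases "n = 0") (auto simp: s_one)
qed (auto simp: fil_iff)

text \<open>Only the left factor is truncated: (x - r N) y is a finite sum of monomial multiples of
  y. Each coefficient of the product is already correct after finitely many such terms.\<close>

lemma expands_mult:
  assumes "expands x f" "expands y g"
  shows "expands (x \<otimes> y) (f \<otimes>\<^bsub>skew_laurent F \<beta>\<^esub> g)"
proof -
  from assms(1) obtain r where r: "x \<in> carrier R" "f \<in> laurent_carrier F" "\<And>n. f n \<in> carrier F"
    "\<And>n. r n \<in> fil n" "\<And>n. r n \<in> carrier R" "\<And>n. r n = s (f n) \<otimes> T n \<oplus> r (n + 1)"
    "\<And>n. (\<forall>j<n. f j = \<zero>\<^bsub>F\<^esub>) \<Longrightarrow> r n = x" by (rule expandsE) blast
  have yg: "y \<in> carrier R" "g \<in> laurent_carrier F" "\<And>n. g n \<in> carrier F"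
    using assms(2) laurent_carrierD by (auto simp: expands_def)
  obtain m where m: "\<forall>n<m. f n = \<zero>\<^bsub>F\<^esub>" using laurent_carrier_bound r(2) by blast
  obtain l where l: "\<forall>n<l. g n = \<zero>\<^bsub>F\<^esub>" using laurent_carrier_bound yg(2) by blast
  have yl: "y \<in> fil l" using expands_fil_iff[OF assms(2)] l by blast
  let ?c = "\<lambda>n i. f i \<otimes>\<^bsub>F\<^esub> \<beta>pow i (g (n - i))"
  have cc: "?c n i \<in> carrier F" for n i using r(3) yg(3) by simp
  have trunc: "expands ((x \<ominus> r (m + int k)) \<otimes> y) (\<lambda>n. \<Oplus>\<^bsub>F\<^esub> i \<in> {m..<m + int k}. ?c n i)" for k
  proof (induction k)
    case 0
    have "r m = x" using r(7) m by blast
    then show ?case using expands_zero r(1) yg(1) by (simp add: minus_eq r_neg)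
  next
    case (Suc k)
    let ?j = "m + int k"
    have "expands ((x \<ominus> r ?j) \<otimes> y \<oplus> s (f ?j) \<otimes> T ?j \<otimes> y)
      (\<lambda>n. (\<Oplus>\<^bsub>F\<^esub> i \<in> {m..<?j}. ?c n i) \<oplus>\<^bsub>F\<^esub> ?c n ?j)"
      by (rule expands_add[OF Suc expands_monomial_mult[OF r(3) assms(2)]])
    moreover have "(x \<ominus> r ?j) \<otimes> y \<oplus> s (f ?j) \<otimes> T ?j \<otimes> y = (x \<ominus> r (?j + 1)) \<otimes> y"
      unfolding r(6)[of ?j] using r(1) yg(1) r(5)[of "?j + 1"] s_closed[OF r(3)[of ?j]] T_carrier[of ?j]
      by algebra
    moreover have "(\<Oplus>\<^bsub>F\<^esub> i \<in> {m..<?j}. ?c n i) \<oplus>\<^bsub>F\<^esub> ?c n ?j = (\<Oplus>\<^bsub>F\<^esub> i \<in> {m..<?j + 1}. ?c n i)" for n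
    proof -
      have "{m..<?j + 1} = insert ?j {m..<?j}" by auto
      then show ?thesis using F.finsum_insert[of "{m..<?j}" ?j "?c n"] cc
        by (simp add: F.a_comm F.finsum_closed)
    qed
    ultimately show ?case by (simp add: ac_simps)
  qed
  let ?fg = "f \<otimes>\<^bsub>skew_laurent F \<beta>\<^esub> g"
  have fg: "?fg n = (\<Oplus>\<^bsub>F\<^esub> i \<in> {i. f i \<noteq> \<zero>\<^bsub>F\<^esub> \<and> g (n - i) \<noteq> \<zero>\<^bsub>F\<^esub>}. ?c n i)" for n
    by (simp add: skew_laurent_def)
  \<comment> \<open>An index i below \<open>m\<close> kills the first factor. For i from
    \<open>N\<close> on, n - i is less than \<open>l\<close>, which kills the second.\<close>
  have agree: "(\<Oplus>\<^bsub>F\<^esub> i \<in> {m..<N}. ?c n i) = ?fg n" if "n < N + l" for n N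
    unfolding fg
  proof (rule F.add.finprod_mono_neutral_cong_right)
    show "{i. f i \<noteq> \<zero>\<^bsub>F\<^esub> \<and> g (n - i) \<noteq> \<zero>\<^bsub>F\<^esub>} \<subseteq> {m..<N}"
    proof
      fix i assume "i \<in> {i. f i \<noteq> \<zero>\<^bsub>F\<^esub> \<and> g (n - i) \<noteq> \<zero>\<^bsub>F\<^esub>}"
      then have "\<not> i < m" "\<not> n - i < l" using m l by auto
      then show "i \<in> {m..<N}" using that by simp
    qed
    show "\<And>i. i \<in> {m..<N} - {i. f i \<noteq> \<zero>\<^bsub>F\<^esub> \<and> g (n - i) \<noteq> \<zero>\<^bsub>F\<^esub>} \<Longrightarrow> ?c n i = \<zero>\<^bsub>F\<^esub>"
      using r(3) yg(3) by auto
  qed (use cc in auto)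
  have "?fg n \<in> carrier F" for n unfolding fg using cc by (intro F.finsum_closed) auto
  \<comment> \<open>\<open>agree\<close> with the empty range, that is, with \<open>N\<close> equal
    to \<open>m\<close>.\<close>
  moreover have "?fg n = \<zero>\<^bsub>F\<^esub>" if "n < m + l" for n
    using agree[OF that] by simp
  ultimately have fgL: "?fg \<in> laurent_carrier F" by (intro laurent_carrierI[of _ "m + l"])
  show ?thesis
  proof (rule expands_approx[OF fgL])
    fix n
    \<comment> \<open>Large enough that the error, the remainder at \<open>?N\<close> times
      \<open>y\<close>, lies in \<open>fil n\<close>; recall that \<open>y\<close> is in
      \<open>fil l\<close>.\<close>
    define k where "k = nat (n - l - m)"
    let ?N = "m + int k"
    have N: "n \<le> ?N + l" by (simp add: k_def)
    have "x \<otimes> y \<ominus> (x \<ominus> r ?N) \<otimes> y = r ?N \<otimes> y" using r(1) yg(1) r(5)[of ?N] by algebra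
    also have "\<dots> \<in> fil n" using fil_mono[OF fil_mult[OF r(4) yl] N] .
    finally show "\<exists>x' h'. expands x' h' \<and> x \<otimes> y \<ominus> x' \<in> fil n \<and> (\<forall>j<n. h' j = ?fg j)"
      using trunc[of k] agree N by (meson less_le_trans)
  qed (use r(1) yg(1) in simp)
qed

text \<open>The two additional clauses keep track of both valuations: the filtration becomes the
  t-adic one, and the residue is determined by the constant term.\<close>

theorem skew_laurent_iso:
  obtains \<psi> where "\<psi> \<in> ring_iso R (skew_laurent F \<beta>)"
    "\<And>x n. x \<in> carrier R \<Longrightarrow> x \<in> fil n \<longleftrightarrow> (\<forall>j<n. \<psi> x j = \<zero>\<^bsub>F\<^esub>)"
    "\<And>x. x \<in> fil 0 \<Longrightarrow> res x = res (s (\<psi> x 0))"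
proof -
  define \<psi> where "\<psi> x = (THE f. expands x f)" for x
  have \<psi>I: "\<psi> x = f" if "expands x f" for x f
    using that expands_unique_series by (auto simp: \<psi>_def)
  have \<psi>: "expands x (\<psi> x)" if "x \<in> carrier R" for x
    using ex_expansion[OF that] \<psi>I by blast
  have "\<psi> \<in> ring_iso R (skew_laurent F \<beta>)"
  proof (rule ring_iso_memI)
    show "bij_betw \<psi> (carrier R) (carrier (skew_laurent F \<beta>))"
    proof (rule bij_betw_imageI)
      show "inj_on \<psi> (carrier R)" using \<psi> expands_unique_value by (metis inj_onI)
      have "f \<in> \<psi> ` carrier R" if f: "f \<in> laurent_carrier F" for f
      proof -
        obtain x where x: "expands x f" using ex_value[OF f] by blast
        then show ?thesis using \<psi>I[OF x] by (auto simp: expands_def)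
      qed
      then show "\<psi> ` carrier R = carrier (skew_laurent F \<beta>)"
        using \<psi> by (auto simp: skew_laurent_def expands_def)
    qed
  next
    fix x y assume "x \<in> carrier R" "y \<in> carrier R"
    then show "\<psi> (x \<otimes> y) = \<psi> x \<otimes>\<^bsub>skew_laurent F \<beta>\<^esub> \<psi> y"
      "\<psi> (x \<oplus> y) = \<psi> x \<oplus>\<^bsub>skew_laurent F \<beta>\<^esub> \<psi> y"
      using \<psi>I[OF expands_mult[OF \<psi> \<psi>]] \<psi>I[OF expands_add[OF \<psi> \<psi>]] by (auto simp: skew_laurent_def)
  next
    show "\<psi> \<one> = \<one>\<^bsub>skew_laurent F \<beta>\<^esub>" using \<psi>I[OF expands_one] by (simp add: skew_laurent_def)
    show "\<psi> x \<in> carrier (skew_laurent F \<beta>)" if "x \<in> carrier R" for x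
      using \<psi>[OF that] by (simp add: skew_laurent_def expands_def)
  qed
  moreover have "res x = res (s (\<psi> x 0))" if x: "x \<in> fil 0" for x
  proof -
    have xc: "x \<in> carrier R" using x fil_carrier by blast
    obtain r where r: "\<And>n. \<psi> x n \<in> carrier F" "\<And>n. r n \<in> fil n" "\<And>n. r n \<in> carrier R"
      "\<And>n. r n = s (\<psi> x n) \<otimes> T n \<oplus> r (n + 1)" "\<And>n. (\<forall>j<n. \<psi> x j = \<zero>\<^bsub>F\<^esub>) \<Longrightarrow> r n = x"
      using expandsE[OF \<psi>[OF xc]] by metis
    have "x = s (\<psi> x 0) \<oplus> r 1"
      using r(4)[of 0] r(5)[of 0] r(1) x expands_fil_iff[OF \<psi>[OF xc], of 0] by simp
    moreover have "(s (\<psi> x 0) \<oplus> r 1) \<ominus> s (\<psi> x 0) = r 1"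
      using s_closed[OF r(1)[of 0]] r(3)[of 1] by algebra
    ultimately have "x \<ominus> s (\<psi> x 0) = r 1" by metis
    then show ?thesis using res_eq_iff[OF x s_fil[OF r(1)]] r(2)[of 1] by simp
  qed
  ultimately show ?thesis using that expands_fil_iff[OF \<psi>] by blast
qed

end

section \<open>Isomorphism classes\<close>

text \<open>Read off from the definitions for an arbitrary record, so that it also applies to
  \<open>skew_laurent\<close>.\<close>

lemma carrier_residue_field: "carrier (residue_field R v) = residue_map R v ` valuation_ring R v"
  by (auto simp: residue_field_def residue_map_def FactRing_def A_RCOSETS_def RCOSETS_def
      a_r_coset_def r_coset_def)

text \<open>Surjectivity of \<open>\<phi>\<close> turns the equalities of sets into pointwise
  equivalences. The cases \<open>k = 0\<close> and \<open>k = 1\<close> of the last hypothesis give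
  the two conditions on the residue fields.\<close>

lemma iso_2dlsfI:
  assumes iso: "\<phi> \<in> ring_iso R R'"
    and O: "\<And>x. x \<in> carrier R \<Longrightarrow> x \<in> valuation_ring R v \<longleftrightarrow> \<phi> x \<in> valuation_ring R' v'"
    and M: "\<And>x. x \<in> carrier R \<Longrightarrow> x \<in> valuation_ideal R v \<longleftrightarrow> \<phi> x \<in> valuation_ideal R' v'"
    and val: "\<And>x k. x \<in> valuation_ring R v \<Longrightarrow> val_ge (residue_field R v) w k (residue_map R v x)
      \<longleftrightarrow> val_ge (residue_field R' v') w' k (residue_map R' v' (\<phi> x))"
  shows "iso_2dlsf R v w R' v' w' \<phi>"
proof -
  have im: "\<phi> ` carrier R = carrier R'" using ring_iso_memE(5)[OF iso] by (simp add: bij_betw_def)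
  have sub: "valuation_ring R v \<subseteq> carrier R" "valuation_ideal R v \<subseteq> carrier R"
    "valuation_ring R' v' \<subseteq> carrier R'" "valuation_ideal R' v' \<subseteq> carrier R'"
    by (auto simp: valuation_ring_def valuation_ideal_def)
  have image: "\<phi> ` A = A'"
    if "A \<subseteq> carrier R" "A' \<subseteq> carrier R'" "\<And>x. x \<in> carrier R \<Longrightarrow> x \<in> A \<longleftrightarrow> \<phi> x \<in> A'" for A A'
  proof (intro equalityI subsetI)
    fix y assume "y \<in> A'"
    with that(2) im obtain x where "x \<in> carrier R" "y = \<phi> x" by (metis imageE subsetD)
    then show "y \<in> \<phi> ` A" using that(3)[of x] \<open>y \<in> A'\<close> by blast
  qed (use that in auto)
  have O': "\<phi> ` valuation_ring R v = valuation_ring R' v'" by (rule image[OF sub(1,3) O])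
  have M': "\<phi> ` valuation_ideal R v = valuation_ideal R' v'" by (rule image[OF sub(2,4) M])
  have "{residue_map R' v' (\<phi> x) | x. x \<in> valuation_ring R v \<and>
      val_ge (residue_field R v) w k (residue_map R v x)} =
    {Y \<in> carrier (residue_field R' v'). val_ge (residue_field R' v') w' k Y}" for k
    unfolding carrier_residue_field O'[symmetric] using val by auto
  then show ?thesis
    using iso O' M' carrier_residue_field[of R v]
    unfolding iso_2dlsf_def valuation_ring_def[of "residue_field R v"] valuation_ideal_def[of "residue_field R v"]
      valuation_ring_def[of "residue_field R' v'"] valuation_ideal_def[of "residue_field R' v'"]
    by (simp cong: conj_cong)
qed

text \<open>The support of a nonzero series is bounded below, so it has a least index, and the
  description in \<open>laurent_val\<close> picks it. For the zero series that description is
  meaningless, but \<open>val_ge\<close> treats zero apart.\<close>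

lemma val_ge_laurent_val:
  assumes f: "f \<in> laurent_carrier F"
  shows "val_ge (skew_laurent F \<beta>) (laurent_val F) n f \<longleftrightarrow> (\<forall>j<n. f j = \<zero>\<^bsub>F\<^esub>)"
proof (cases "\<forall>j. f j = \<zero>\<^bsub>F\<^esub>")
  case True
  then show ?thesis by (auto simp: val_ge_def skew_laurent_def)
next
  case False
  then obtain i where i: "f i \<noteq> \<zero>\<^bsub>F\<^esub>" by blast
  obtain m where m: "\<forall>j<m. f j = \<zero>\<^bsub>F\<^esub>" using f by (auto simp: laurent_carrier_def)
  define k where "k = (LEAST k. f (m + int k) \<noteq> \<zero>\<^bsub>F\<^esub>)"
  have "f (m + int (nat (i - m))) \<noteq> \<zero>\<^bsub>F\<^esub>" using i m by (cases "i < m") auto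
  then have k: "f (m + int k) \<noteq> \<zero>\<^bsub>F\<^esub>" unfolding k_def by (rule LeastI)
  have k': "f j = \<zero>\<^bsub>F\<^esub>" if "j < m + int k" for j
  proof (cases "j < m")
    case False
    then have "nat (j - m) < k" "j = m + int (nat (j - m))" using that by auto
    then show ?thesis using not_less_Least unfolding k_def by metis
  qed (use m in blast)
  have "laurent_val F f = m + int k"
    unfolding laurent_val_def
  proof (rule the_equality)
    show "f (m + int k) \<noteq> \<zero>\<^bsub>F\<^esub> \<and> (\<forall>j<m + int k. f j = \<zero>\<^bsub>F\<^esub>)" using k k' by blast
    show "n = m + int k" if "f n \<noteq> \<zero>\<^bsub>F\<^esub> \<and> (\<forall>j<n. f j = \<zero>\<^bsub>F\<^esub>)" for n
      using that k k' by (meson linorder_neqE)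
  qed
  moreover have "f \<noteq> \<zero>\<^bsub>skew_laurent F \<beta>\<^esub>" using i by (auto simp: skew_laurent_def)
  ultimately show ?thesis using k k' by (auto simp: val_ge_def not_le)
qed

lemma
  shows mem_valuation_ring_laurent: "f \<in> valuation_ring (skew_laurent F \<beta>) (laurent_val F) \<longleftrightarrow>
      f \<in> laurent_carrier F \<and> (\<forall>j<0. f j = \<zero>\<^bsub>F\<^esub>)"
    and mem_valuation_ideal_laurent: "f \<in> valuation_ideal (skew_laurent F \<beta>) (laurent_val F) \<longleftrightarrow>
      f \<in> laurent_carrier F \<and> (\<forall>j<1. f j = \<zero>\<^bsub>F\<^esub>)"
  using val_ge_laurent_val[of f F \<beta>]
  by (auto simp: valuation_ring_def valuation_ideal_def skew_laurent_def)

text \<open>\<open>laurent_res_val\<close> evaluates an arbitrary representative of the coset. The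
  choice is harmless: elements of the valuation ideal have zero constant term, so the constant term
  is the same on the whole coset.\<close>

lemma val_ge_laurent_res_val:
  assumes "ring F" and f: "f \<in> valuation_ring (skew_laurent F \<beta>) (laurent_val F)"
  shows "val_ge (residue_field (skew_laurent F \<beta>) (laurent_val F)) (laurent_res_val w) k
      (residue_map (skew_laurent F \<beta>) (laurent_val F) f) \<longleftrightarrow> val_ge F w k (f 0)"
proof -
  interpret F: ring F by fact
  let ?M = "valuation_ideal (skew_laurent F \<beta>) (laurent_val F)"
  let ?Y = "residue_map (skew_laurent F \<beta>) (laurent_val F) f"
  note M = mem_valuation_ideal_laurent[of _ F \<beta>]
  have fc: "f n \<in> carrier F" for n using f by (auto simp: mem_valuation_ring_laurent laurent_carrier_def)
  have Y: "?Y = {\<lambda>n. h n \<oplus>\<^bsub>F\<^esub> f n | h. h \<in> ?M}"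
    by (auto simp: residue_map_def a_r_coset_def r_coset_def skew_laurent_def)
  have Mc: "h n \<in> carrier F" if "h \<in> ?M" for h n using that by (auto simp: M laurent_carrier_def)
  have "(\<lambda>_. \<zero>\<^bsub>F\<^esub>) \<in> ?M" by (auto simp: M laurent_carrier_def)
  then have fY: "f \<in> ?Y" using fc unfolding Y by (auto intro!: exI[of _ "\<lambda>_. \<zero>\<^bsub>F\<^esub>"])
  have "g 0 = f 0" if "g \<in> ?Y" for g
    using that fc by (auto simp: Y M)
  from this[OF someI[of "\<lambda>g. g \<in> ?Y", OF fY]] have val: "laurent_res_val w ?Y = w (f 0)"
    by (simp add: laurent_res_val_def)
  have "?Y = ?M \<longleftrightarrow> f 0 = \<zero>\<^bsub>F\<^esub>"
  proof
    assume "?Y = ?M" with fY show "f 0 = \<zero>\<^bsub>F\<^esub>" by (simp add: M)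
  next
    assume "f 0 = \<zero>\<^bsub>F\<^esub>"
    then have f0: "\<forall>j<1. f j = \<zero>\<^bsub>F\<^esub>"
      using f by (auto simp: mem_valuation_ring_laurent) (smt (verit))
    show "?Y = ?M"
    proof (intro equalityI subsetI)
      fix g assume "g \<in> ?Y"
      then obtain h where h: "h \<in> ?M" "g = (\<lambda>n. h n \<oplus>\<^bsub>F\<^esub> f n)" unfolding Y by blast
      then show "g \<in> ?M" using f0 Mc[OF h(1)] fc by (auto simp: M laurent_carrier_def intro!: exI[of _ 1])
    next
      fix g assume g: "g \<in> ?M"
      define h where "h n = g n \<ominus>\<^bsub>F\<^esub> f n" for n
      have "h \<in> ?M" using g f0 Mc[OF g] fc by (auto simp: h_def M laurent_carrier_def F.minus_eq intro!: exI[of _ 1])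
      moreover have "g = (\<lambda>n. h n \<oplus>\<^bsub>F\<^esub> f n)"
      proof
        fix n show "g n = h n \<oplus>\<^bsub>F\<^esub> f n"
          unfolding h_def using Mc[OF g, of n] fc[of n] by algebra
      qed
      ultimately show "g \<in> ?Y" unfolding Y by blast
    qed
  qed
  moreover have "\<zero>\<^bsub>residue_field (skew_laurent F \<beta>) (laurent_val F)\<^esub> = ?M"
    by (simp add: residue_field_def FactRing_def)
  ultimately show ?thesis by (simp add: val_ge_def val)
qed

lemma two_dim_commI:
  assumes "two_dim_local_skew_field R v w" "cring (residue_field R v)"
  shows "two_dim_comm R v w"
  using assms by (simp add: two_dim_local_skew_field_def two_dim_comm_def two_dim_comm_axioms_def
      comm_residue_dvsf_def comm_residue_dvsf_axioms_def flip: complete_dvsf_loc_iff)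

context two_dim_comm begin

text \<open>The coefficient embedding is the section after \<open>f\<close>. With \<open>f\<close>
  the identity this gives the Laurent series over K_1; with \<open>f\<close> a conjugating
  isomorphism it expands a second skew field over the residue field of the first.\<close>

lemma ex_skew_laurent_iso:
  assumes np: "aut_nonperiodic K1 \<alpha>" and F: "ring F" and f: "f \<in> ring_iso F K1"
    and \<beta>: "bij_betw \<beta> (carrier F) (carrier F)" and f\<beta>: "\<And>a. a \<in> carrier F \<Longrightarrow> f (\<beta> a) = \<alpha> (f a)"
  obtains \<psi> where "\<psi> \<in> ring_iso R (skew_laurent F \<beta>)"
    "\<And>x n. x \<in> carrier R \<Longrightarrow> x \<in> fil n \<longleftrightarrow> (\<forall>j<n. \<psi> x j = \<zero>\<^bsub>F\<^esub>)"
    "\<And>x. x \<in> fil 0 \<Longrightarrow> res x = f (\<psi> x 0)"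
proof -
  obtain s t where s: "s \<in> ring_hom K1 (R\<lparr>carrier := valuation_ring R v\<rparr>)"
    "\<And>Y. Y \<in> carrier K1 \<Longrightarrow> res (s Y) = Y"
    "uniformized_dvsf R v t" "\<And>Y. Y \<in> carrier K1 \<Longrightarrow> t \<otimes> s Y = s (\<alpha> Y) \<otimes> t"
    using ex_section[OF np] by metis
  interpret uniformized_dvsf R v t by fact
  interpret F: ring F by fact
  note f = ring_iso_memE[OF f] and fh = f
  interpret E: skew_expansion R v t F "s \<circ> f" \<beta>
  proof unfold_locales
    show "s \<circ> f \<in> ring_hom F (R\<lparr>carrier := valuation_ring R v\<rparr>)"
      using ring_hom_trans[OF _ s(1)] fh by (auto simp: ring_iso_def)
    have "bij_betw (\<lambda>a. res ((s \<circ> f) a)) (carrier F) (carrier K1) \<longleftrightarrow> bij_betw f (carrier F) (carrier K1)"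
      by (rule bij_betw_cong) (simp add: s(2) f(1))
    then show "bij_betw (\<lambda>a. res ((s \<circ> f) a)) (carrier F) (carrier K1)" using f(5) by simp
    show "bij_betw \<beta> (carrier F) (carrier F)" by fact
    show "t \<otimes> (s \<circ> f) a = (s \<circ> f) (\<beta> a) \<otimes> t" if "a \<in> carrier F" for a
      using s(4) f\<beta> f(1) that by simp
  qed
  obtain \<psi> where \<psi>: "\<psi> \<in> ring_iso R (skew_laurent F \<beta>)"
    "\<And>x n. x \<in> carrier R \<Longrightarrow> x \<in> fil n \<longleftrightarrow> (\<forall>j<n. \<psi> x j = \<zero>\<^bsub>F\<^esub>)"
    "\<And>x. x \<in> fil 0 \<Longrightarrow> res x = res ((s \<circ> f) (\<psi> x 0))"
    using E.skew_laurent_iso by metis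
  have "res x = f (\<psi> x 0)" if "x \<in> fil 0" for x
  proof -
    have "\<psi> x 0 \<in> carrier F"
      using ring_iso_memE(1)[OF \<psi>(1), of x] that fil_carrier by (auto simp: skew_laurent_def laurent_carrier_def)
    then show ?thesis using \<psi>(3)[OF that] s(2) f(1) by simp
  qed
  with \<psi> that show ?thesis by blast
qed

lemma splits_if_nonperiodic:
  assumes "aut_nonperiodic K1 \<alpha>" shows "splits R v"
  using ex_section[OF assms] unfolding splits_def by metis

text \<open>A section sends multiples of one to multiples of one and is injective, since
  \<open>res\<close> undoes it.\<close>

lemma ring_char_residue_field:
  assumes "splits R v" shows "ring_char R = ring_char K1"
proof -
  obtain s where s: "s \<in> ring_hom K1 (R\<lparr>carrier := valuation_ring R v\<rparr>)"
    "\<And>Y. Y \<in> carrier K1 \<Longrightarrow> res (s Y) = Y"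
    using assms unfolding splits_def by metis
  have add: "s (Y \<oplus>\<^bsub>K1\<^esub> Z) = s Y \<oplus> s Z" if "Y \<in> carrier K1" "Z \<in> carrier K1" for Y Z
    using ring_hom_add[OF s(1) that] by simp
  have c: "s Y \<in> carrier R" if "Y \<in> carrier K1" for Y
    using ring_hom_closed[OF s(1) that] by (simp add: valuation_ring_def)
  have s0: "s \<zero>\<^bsub>K1\<^esub> = \<zero>" using add[of "\<zero>\<^bsub>K1\<^esub>" "\<zero>\<^bsub>K1\<^esub>"] c[of "\<zero>\<^bsub>K1\<^esub>"] by simp
  have s1: "s \<one>\<^bsub>K1\<^esub> = \<one>" using ring_hom_one[OF s(1)] by simp
  have K: "[n] \<cdot>\<^bsub>K1\<^esub> \<one>\<^bsub>K1\<^esub> \<in> carrier K1" for n :: nat by simp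
  have *: "s ([n] \<cdot>\<^bsub>K1\<^esub> \<one>\<^bsub>K1\<^esub>) = [n] \<cdot> \<one>" for n :: nat
    by (induction n) (simp_all add: s0 s1 add)
  have "[n] \<cdot> \<one> = \<zero> \<longleftrightarrow> [n] \<cdot>\<^bsub>K1\<^esub> \<one>\<^bsub>K1\<^esub> = \<zero>\<^bsub>K1\<^esub>" for n :: nat
    using *[of n] s(2)[OF K[of n]] s(2)[OF K1.zero_closed] s0 by metis
  then show ?thesis by (simp only: ring_char_def)
qed

lemma isomorphic_skew_laurent:
  assumes np: "aut_nonperiodic K1 \<alpha>"
  shows "isomorphic_2dlsf R v w (skew_laurent K1 \<alpha>) (laurent_val K1) (laurent_res_val w)"
proof -
  obtain \<psi> where \<psi>: "\<psi> \<in> ring_iso R (skew_laurent K1 \<alpha>)"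
    "\<And>x n. x \<in> carrier R \<Longrightarrow> x \<in> fil n \<longleftrightarrow> (\<forall>j<n. \<psi> x j = \<zero>\<^bsub>K1\<^esub>)"
    "\<And>x. x \<in> fil 0 \<Longrightarrow> res x = id (\<psi> x 0)"
    using ex_skew_laurent_iso[OF np ring_K1 ring_iso_set_refl canonical_aut(5)] by (metis id_apply)
  have c: "\<psi> x \<in> laurent_carrier K1" if "x \<in> carrier R" for x
    using ring_iso_memE(1)[OF \<psi>(1) that] by (simp add: skew_laurent_def)
  have O: "x \<in> valuation_ring R v \<longleftrightarrow> \<psi> x \<in> valuation_ring (skew_laurent K1 \<alpha>) (laurent_val K1)"
    if "x \<in> carrier R" for x
    using \<psi>(2)[OF that] c[OF that] by (simp add: valuation_ring_eq mem_valuation_ring_laurent)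
  have "iso_2dlsf R v w (skew_laurent K1 \<alpha>) (laurent_val K1) (laurent_res_val w) \<psi>"
  proof (rule iso_2dlsfI[OF \<psi>(1) O])
    fix x assume x: "x \<in> carrier R"
    show "x \<in> valuation_ideal R v \<longleftrightarrow> \<psi> x \<in> valuation_ideal (skew_laurent K1 \<alpha>) (laurent_val K1)"
      using \<psi>(2)[OF x] c[OF x] by (simp add: valuation_ideal_eq mem_valuation_ideal_laurent)
  next
    fix x k assume x: "x \<in> valuation_ring R v"
    then have "x \<in> carrier R" by (simp add: valuation_ring_def)
    with x have "\<psi> x \<in> valuation_ring (skew_laurent K1 \<alpha>) (laurent_val K1)" using O by blast
    then show "val_ge K1 w k (res x) \<longleftrightarrow> val_ge (residue_field (skew_laurent K1 \<alpha>) (laurent_val K1))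
      (laurent_res_val w) k (residue_map (skew_laurent K1 \<alpha>) (laurent_val K1) (\<psi> x))"
      using val_ge_laurent_res_val[OF ring_K1, of "\<psi> x" \<alpha> w k] \<psi>(3)[of x] x by (simp add: valuation_ring_eq)
  qed
  then show ?thesis unfolding isomorphic_2dlsf_def by blast
qed

end

text \<open>Both skew fields are mapped onto the same Laurent series field over the residue field of
  \<open>R\<close>, the second one through \<open>h\<close>. The composite \<open>\<phi>\<close>
  therefore induces \<open>h\<close> on residues.\<close>

lemma isomorphic_if_conjugate:
  assumes "two_dim_comm R v w" "two_dim_comm R' v' w'"
    and np: "aut_nonperiodic (residue_field R v) (canonical_aut R v)"
      "aut_nonperiodic (residue_field R' v') (canonical_aut R' v')"
    and h: "h \<in> ring_iso (residue_field R v) (residue_field R' v')"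
    and conj: "\<And>Y. Y \<in> carrier (residue_field R v) \<Longrightarrow> h (canonical_aut R v Y) = canonical_aut R' v' (h Y)"
  shows "isomorphic_2dlsf R v w R' v' w'"
proof -
  interpret A: two_dim_comm R v w by fact
  interpret B: two_dim_comm R' v' w' by fact
  obtain \<psi> where \<psi>: "\<psi> \<in> ring_iso R (skew_laurent A.K1 A.\<alpha>)"
    "\<And>x n. x \<in> carrier R \<Longrightarrow> x \<in> A.fil n \<longleftrightarrow> (\<forall>j<n. \<psi> x j = \<zero>\<^bsub>A.K1\<^esub>)"
    "\<And>x. x \<in> A.fil 0 \<Longrightarrow> A.res x = id (\<psi> x 0)"
    using A.ex_skew_laurent_iso[OF np(1) A.ring_K1 ring_iso_set_refl A.canonical_aut(5)] by (metis id_apply)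
  obtain \<chi> where \<chi>: "\<chi> \<in> ring_iso R' (skew_laurent A.K1 A.\<alpha>)"
    "\<And>x n. x \<in> carrier R' \<Longrightarrow> x \<in> B.fil n \<longleftrightarrow> (\<forall>j<n. \<chi> x j = \<zero>\<^bsub>A.K1\<^esub>)"
    "\<And>x. x \<in> B.fil 0 \<Longrightarrow> B.res x = h (\<chi> x 0)"
  proof (rule B.ex_skew_laurent_iso[OF np(2) A.ring_K1 h A.canonical_aut(5) conj])
    fix \<chi> assume "\<chi> \<in> ring_iso R' (skew_laurent A.K1 A.\<alpha>)"
      "\<And>x n. x \<in> carrier R' \<Longrightarrow> x \<in> B.fil n \<longleftrightarrow> (\<forall>j<n. \<chi> x j = \<zero>\<^bsub>A.K1\<^esub>)"
      "\<And>x. x \<in> B.fil 0 \<Longrightarrow> B.res x = h (\<chi> x 0)"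
    then show thesis by (rule that)
  qed
  define \<phi> where "\<phi> = inv_into (carrier R') \<chi> \<circ> \<psi>"
  have \<phi>: "\<phi> \<in> ring_iso R R'"
    unfolding \<phi>_def by (rule ring_iso_set_trans[OF \<psi>(1) ring_iso_set_sym[OF B.ring_axioms \<chi>(1)]])
  have \<phi>c: "\<phi> x \<in> carrier R'" if "x \<in> carrier R" for x using ring_iso_memE(1)[OF \<phi> that] .
  have \<chi>\<phi>: "\<chi> (\<phi> x) = \<psi> x" if "x \<in> carrier R" for x
    using ring_iso_memE(1)[OF \<psi>(1) that] ring_iso_memE(5)[OF \<chi>(1)]
    by (simp add: \<phi>_def bij_betw_def f_inv_into_f)
  have fil: "x \<in> A.fil n \<longleftrightarrow> \<phi> x \<in> B.fil n" if "x \<in> carrier R" for x n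
    using \<psi>(2)[OF that] \<chi>(2)[OF \<phi>c[OF that]] \<chi>\<phi>[OF that] by simp
  have res: "B.res (\<phi> x) = h (A.res x)" if "x \<in> A.fil 0" for x
  proof -
    have x: "x \<in> carrier R" using that A.fil_carrier by blast
    have "\<phi> x \<in> B.fil 0" using fil[OF x] that by blast
    then show ?thesis using \<chi>(3) \<psi>(3)[OF that] \<chi>\<phi>[OF x] by simp
  qed
  have h0: "h \<zero>\<^bsub>A.K1\<^esub> = \<zero>\<^bsub>B.K1\<^esub>"
    using ring_hom_zero[of h A.K1 B.K1] h A.ring_K1 B.ring_K1 by (simp add: ring_iso_def)
  have hval: "val_ge A.K1 w k Y \<longleftrightarrow> val_ge B.K1 w' k (h Y)" if "Y \<in> carrier A.K1" for Y k
  proof (cases "Y = \<zero>\<^bsub>A.K1\<^esub>")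
    case True then show ?thesis using h0 by (simp add: val_ge_def)
  next
    case False
    then have "h Y \<noteq> \<zero>\<^bsub>B.K1\<^esub>"
      using ring_iso_memE(5)[OF h] that h0 A.K1.zero_closed unfolding bij_betw_def inj_on_def by metis
    \<comment> \<open>\<open>h\<close> is only a ring isomorphism; its compatibility with the
      valuations is forced by their uniqueness.\<close>
    moreover have "w' (h Y) = w Y"
      by (rule valuation_ring_iso_invariant[OF h A.complete_K1 A.comm_K1 _ that False])
        (use B.complete_K1 in \<open>simp add: complete_dvsf_loc_def\<close>)
    ultimately show ?thesis using False by (simp add: val_ge_def)
  qed
  have "iso_2dlsf R v w R' v' w' \<phi>"
    by (rule iso_2dlsfI[OF \<phi>])
      (simp_all add: A.valuation_ring_eq A.valuation_ideal_eq B.valuation_ring_eq B.valuation_ideal_eq fil res hval)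
  then show ?thesis unfolding isomorphic_2dlsf_def by blast
qed

text \<open>An isomorphism carries a prime element to a prime element, so it carries one conjugation
  to the other; passing to residues gives the relation between the canonical automorphisms.\<close>

lemma conjugate_if_isomorphic:
  assumes "two_dim_comm R v w" "two_dim_comm R' v' w'" "isomorphic_2dlsf R v w R' v' w'"
  obtains h where "h \<in> ring_iso (residue_field R v) (residue_field R' v')"
    "\<And>Y. Y \<in> carrier (residue_field R v) \<Longrightarrow> h (canonical_aut R v Y) = canonical_aut R' v' (h Y)"
proof -
  interpret A: two_dim_comm R v w by fact
  interpret B: two_dim_comm R' v' w' by fact
  obtain \<phi> where "iso_2dlsf R v w R' v' w' \<phi>" using assms(3) unfolding isomorphic_2dlsf_def by blast
  then have iso: "\<phi> \<in> ring_iso R R'" and O: "\<phi> ` A.fil 0 = B.fil 0" and M: "\<phi> ` A.fil 1 = B.fil 1"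
    unfolding iso_2dlsf_def A.valuation_ring_eq A.valuation_ideal_eq B.valuation_ring_eq B.valuation_ideal_eq
    by simp_all
  note \<phi> = ring_iso_memE[OF iso]
  have \<phi>0: "\<phi> \<zero>\<^bsub>R\<^esub> = \<zero>\<^bsub>R'\<^esub>"
    using ring_hom_zero[of \<phi> R R'] iso A.ring_axioms B.ring_axioms by (simp add: ring_iso_def)
  have inj: "x = y" if "\<phi> x = \<phi> y" "x \<in> carrier R" "y \<in> carrier R" for x y
    using \<phi>(5) that unfolding bij_betw_def inj_on_def by blast
  have nz: "\<phi> x \<noteq> \<zero>\<^bsub>R'\<^esub>" if "x \<in> carrier R" "x \<noteq> \<zero>\<^bsub>R\<^esub>" for x
    using inj[of x "\<zero>\<^bsub>R\<^esub>"] \<phi>0 that by auto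
  \<comment> \<open>Residue classes are sets of elements, so the induced map is the direct
    image.\<close>
  define h where "h Y = \<phi> ` Y" for Y
  have h: "h (A.res x) = B.res (\<phi> x)" if "x \<in> A.fil 0" for x
  proof -
    have x: "x \<in> carrier R" using that A.fil_carrier by blast
    have "\<phi> ` {m \<oplus>\<^bsub>R\<^esub> x | m. m \<in> A.fil 1} = {\<phi> m \<oplus>\<^bsub>R'\<^esub> \<phi> x | m. m \<in> A.fil 1}"
      using \<phi>(3)[OF A.fil_carrier x] by (auto simp: image_iff) metis
    also have "\<dots> = {m \<oplus>\<^bsub>R'\<^esub> \<phi> x | m. m \<in> \<phi> ` A.fil 1}" by blast
    finally show ?thesis unfolding M A.res_altdef B.res_altdef h_def .
  qed
  have \<phi>O: "\<phi> x \<in> B.fil 0" if "x \<in> A.fil 0" for x using that O by blast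
  have h_iso: "h \<in> ring_iso A.K1 B.K1"
  proof (rule ring_iso_memI)
    fix Y Z assume "Y \<in> carrier A.K1" "Z \<in> carrier A.K1"
    then obtain y z where y: "y \<in> A.fil 0" "Y = A.res y" and z: "z \<in> A.fil 0" "Z = A.res z"
      using A.res_surj by metis
    note c = A.fil_carrier[OF y(1)] A.fil_carrier[OF z(1)]
    show "h Y \<in> carrier B.K1" using y h \<phi>O by simp
    show "h (Y \<oplus>\<^bsub>A.K1\<^esub> Z) = h Y \<oplus>\<^bsub>B.K1\<^esub> h Z"
      using y z h \<phi>O \<phi>(3)[OF c] A.fil_add by (simp flip: A.res_add B.res_add)
    show "h (Y \<otimes>\<^bsub>A.K1\<^esub> Z) = h Y \<otimes>\<^bsub>B.K1\<^esub> h Z"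
      using y z h \<phi>O \<phi>(2)[OF c] A.fil_mult_l by (simp flip: A.res_mult B.res_mult)
  next
    show "h \<one>\<^bsub>A.K1\<^esub> = \<one>\<^bsub>B.K1\<^esub>" using h[of "\<one>\<^bsub>R\<^esub>"] \<phi>(4) by (simp add: A.res_one B.res_one)
  next
    have "h ` A.res ` A.fil 0 = B.res ` \<phi> ` A.fil 0" using h by (auto simp: image_iff)
    then have "h ` carrier A.K1 = carrier B.K1"
      unfolding carrier_residue_field A.valuation_ring_eq B.valuation_ring_eq O .
    moreover have "inj_on h (carrier A.K1)"
    proof (rule inj_onI)
      fix Y Z assume "Y \<in> carrier A.K1" "Z \<in> carrier A.K1" "h Y = h Z"
      then have "Y \<subseteq> carrier R" "Z \<subseteq> carrier R"
        using A.res_surj A.fil_carrier unfolding A.res_altdef by (blast intro: A.add.m_closed)+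
      then show "Y = Z" using \<open>h Y = h Z\<close> \<phi>(5) inj_on_image_eq_iff unfolding h_def bij_betw_def by metis
    qed
    ultimately show "bij_betw h (carrier A.K1) (carrier B.K1)" by (simp add: bij_betw_def)
  qed
  obtain t where "uniformized_dvsf R v t" by (rule A.ex_uniformizer)
  then interpret A: uniformized_dvsf R v t .
  have tB: "\<phi> t \<in> carrier R'" "\<phi> t \<noteq> \<zero>\<^bsub>R'\<^esub>" using \<phi>(1) nz by simp_all
  \<comment> \<open>A prime element u of the target is the image of z t with z integral. In 1 =
    v'(\<phi> z) + v'(\<phi> t) the first term is at least 0 and the second at least 1.\<close>
  have val: "v' (\<phi> t) = 1"
  proof -
    obtain u where u: "uniformized_dvsf R' v' u" by (rule B.ex_uniformizer)
    then interpret B: uniformized_dvsf R' v' u .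
    have "t \<in> A.fil 1" "u \<in> B.fil 1" by (simp_all add: A.fil_iff B.fil_iff)
    then obtain x where x: "x \<in> A.fil 1" "u = \<phi> x" and t1: "\<phi> t \<in> B.fil 1" using M by blast
    obtain z where z: "z \<in> A.fil 0" "x = z \<otimes>\<^bsub>R\<^esub> A.T 1" using A.fil_divide[OF x(1)] by blast
    have u: "u = \<phi> z \<otimes>\<^bsub>R'\<^esub> \<phi> t" using x z \<phi>(2)[OF A.fil_carrier[OF z(1)]] by simp
    then have zn: "\<phi> z \<noteq> \<zero>\<^bsub>R'\<^esub>" using tB B.t_nonzero by auto
    then have "1 = v' (\<phi> z) + v' (\<phi> t)"
      using B.val_t B.val_mult[of "\<phi> z" "\<phi> t"] tB B.fil_carrier[OF \<phi>O[OF z(1)]] u by simp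
    then show ?thesis using t1 tB zn \<phi>O[OF z(1)] by (auto simp: B.fil_iff)
  qed
  have \<phi>inv: "\<phi> (inv\<^bsub>R\<^esub> t) = inv\<^bsub>R'\<^esub> (\<phi> t)"
  proof -
    have "\<phi> (inv\<^bsub>R\<^esub> t) \<otimes>\<^bsub>R'\<^esub> \<phi> t = inv\<^bsub>R'\<^esub> (\<phi> t) \<otimes>\<^bsub>R'\<^esub> \<phi> t"
      using \<phi>(2)[of "inv\<^bsub>R\<^esub> t" t] \<phi>(4) tB by simp
    then show ?thesis
      using B.mult_right_cancel[OF tB \<phi>(1) B.inv_nonzero_closed[OF tB]]
        A.inv_nonzero_closed[OF A.t_carrier A.t_nonzero] by blast
  qed
  have "h (A.\<alpha> Y) = B.\<alpha> (h Y)" if Y: "Y \<in> carrier A.K1" for Y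
  proof -
    obtain y where y: "y \<in> A.fil 0" "Y = A.res y" using A.res_surj[OF Y] by blast
    note yc = A.fil_carrier[OF y(1)]
    have "h (A.\<alpha> Y) = B.res (\<phi> (t \<otimes>\<^bsub>R\<^esub> y \<otimes>\<^bsub>R\<^esub> inv\<^bsub>R\<^esub> t))"
      using A.canonical_aut_res[OF A.t_carrier A.t_nonzero A.val_t y(1)] y(2)
        h[OF A.conj_fil[OF A.t_carrier A.t_nonzero y(1)]] by simp
    also have "\<phi> (t \<otimes>\<^bsub>R\<^esub> y \<otimes>\<^bsub>R\<^esub> inv\<^bsub>R\<^esub> t) = \<phi> t \<otimes>\<^bsub>R'\<^esub> \<phi> y \<otimes>\<^bsub>R'\<^esub> inv\<^bsub>R'\<^esub> (\<phi> t)"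
      using \<phi>(2) yc by (simp add: \<phi>inv)
    also have "B.res \<dots> = B.\<alpha> (h Y)"
      using B.canonical_aut_res[OF tB val \<phi>O[OF y(1)]] h[OF y(1)] y(2) by simp
    finally show ?thesis .
  qed
  with h_iso that show ?thesis by blast
qed

theorem theorem8p2:
  fixes R :: "('a,'m) ring_scheme" and v2 :: "'a \<Rightarrow> int" and v1 :: "'a set \<Rightarrow> int"
  assumes "two_dim_local_skew_field R v2 v1"
    and "cring (residue_field R v2)"
    and "aut_nonperiodic (residue_field R v2) (canonical_aut R v2)"
  shows "ring_char R = ring_char (residue_field R v2) \<and> splits R v2 \<and>
         isomorphic_2dlsf R v2 v1
           (skew_laurent (residue_field R v2) (canonical_aut R v2))
           (laurent_val (residue_field R v2)) (laurent_res_val v1) \<and>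
         (\<forall>(R' :: ('c,'n) ring_scheme) v2' v1'.
            two_dim_local_skew_field R' v2' v1' \<and> cring (residue_field R' v2') \<and>
            aut_nonperiodic (residue_field R' v2') (canonical_aut R' v2') \<longrightarrow>
            (isomorphic_2dlsf R v2 v1 R' v2' v1' \<longleftrightarrow>
              (\<exists>f \<in> ring_iso (residue_field R v2) (residue_field R' v2').
                 \<forall>Y \<in> carrier (residue_field R v2).
                   canonical_aut R v2 Y =
                     inv_into (carrier (residue_field R v2)) f (canonical_aut R' v2' (f Y)))))"
proof (intro conjI allI impI)
  interpret A: two_dim_comm R v2 v1 by (rule two_dim_commI[OF assms(1,2)])
  show "splits R v2" by (rule A.splits_if_nonperiodic[OF assms(3)])
  then show "ring_char R = ring_char A.K1" by (rule A.ring_char_residue_field)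
  show "isomorphic_2dlsf R v2 v1 (skew_laurent A.K1 A.\<alpha>) (laurent_val A.K1) (laurent_res_val v1)"
    by (rule A.isomorphic_skew_laurent[OF assms(3)])
  fix R' :: "('c,'n) ring_scheme" and v2' v1'
  assume R': "two_dim_local_skew_field R' v2' v1' \<and> cring (residue_field R' v2') \<and>
    aut_nonperiodic (residue_field R' v2') (canonical_aut R' v2')"
  interpret B: two_dim_comm R' v2' v1' using R' by (intro two_dim_commI) auto
  \<comment> \<open>Moves the inverse of \<open>f\<close> to the other side, the form in which both
    directions are proved.\<close>
  have conj_iff: "A.\<alpha> Y = inv_into (carrier A.K1) f (B.\<alpha> (f Y)) \<longleftrightarrow> f (A.\<alpha> Y) = B.\<alpha> (f Y)"
    if "f \<in> ring_iso A.K1 B.K1" "Y \<in> carrier A.K1" for f Y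
    using ring_iso_memE(1,5)[OF that(1)] A.canonical_aut(1)[OF that(2)] B.canonical_aut(1) that(2)
    by (metis bij_betw_inv_into_left bij_betw_inv_into_right)
  show "isomorphic_2dlsf R v2 v1 R' v2' v1' \<longleftrightarrow>
    (\<exists>f \<in> ring_iso A.K1 B.K1. \<forall>Y \<in> carrier A.K1. A.\<alpha> Y = inv_into (carrier A.K1) f (B.\<alpha> (f Y)))"
    (is "?L \<longleftrightarrow> ?R")
  proof
    assume ?L
    then obtain f where "f \<in> ring_iso A.K1 B.K1" "\<And>Y. Y \<in> carrier A.K1 \<Longrightarrow> f (A.\<alpha> Y) = B.\<alpha> (f Y)"
      using conjugate_if_isomorphic[OF A.two_dim_comm_axioms B.two_dim_comm_axioms] by metis
    then show ?R using conj_iff by auto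
  next
    assume ?R
    then obtain f where f: "f \<in> ring_iso A.K1 B.K1" "\<And>Y. Y \<in> carrier A.K1 \<Longrightarrow> f (A.\<alpha> Y) = B.\<alpha> (f Y)"
      using conj_iff by metis
    show ?L
      by (rule isomorphic_if_conjugate[OF A.two_dim_comm_axioms B.two_dim_comm_axioms assms(3) _ f])
        (use R' in blast)
  qed
qed

end
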